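(* Let $K$ be a compact space that admits local compensation. Let $f\in B_{C(K)}\setminus\{0\}$ and let $\varepsilon$ satisfy $1-\|f\|<\varepsilon<1$. Then there exists $f_0\in S_{C(K)}$ such that for every $F\in W(K)$ there is an $\omega^*$-continuous function $$\mathcal{P}_F\colon F^{-1}\big(\pi_2(f,\varepsilon^2/6)\big)\to\pi_2(f_0)$$ such that: (i) $\pi_2(f)\subseteq\pi_2(f_0)$ and $\|f-f_0\|\le\varepsilon$; (ii) $\|\mathcal{P}_F(t)-F(t)\|\le\varepsilon$ for every $t\in F^{-1}(\pi_2(f,\varepsilon^2/6))$.
   Context: A compact space is a compact Hausdorff topological space. $C(K)$ is the real Banach space of continuous real-valued functions on $K$ with the supremum norm, $B_{C(K)}$ and $S_{C(K)}$ are its closed unit ball and unit sphere; its dual is identified with $\mathcal{M}(K)$, the space of regular Borel signed measures on $K$ with the total variation norm, and $B_{\mathcal{M}(K)}$ is its closed unit ball. $\omega^*$ denotes the weak$^*$ topology of $\mathcal{M}(K)=C(K)^*$; we write $\mu(g)=\int_K g\,d\mu$. For $\mu\in\mathcal{M}(K)$, $\mu^+$ is its positive part. For $g\in B_{C(K)}$ and $\delta>0$: $\pi_2(g)=\{\mu\in B_{\mathcal{M}(K)}\colon \mu(g)=1\}$ and $\pi_2(g,\delta)=\{\mu\in B_{\mathcal{M}(K)}\colon \mu(g)\ge 1-\delta\}$. $\nu\in\mathcal{M}(K)$ is a compensation of $\mu\in\mathcal{M}(K)$ if: $0\le\nu\le\mu^+$ and $\nu(K)=\mu(K)$ in case $\mu(K)>0$;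 and $\nu=0$ in case $\mu(K)\le 0$. $W(K)$ is the set of all $\omega^*$-continuous functions $F\colon K\to B_{\mathcal{M}(K)}$. $G\in W(K)$ is a compensation of $F\in W(K)$ if $G(t)$ is a compensation of $F(t)$ for every $t\in K$. $K$ admits local compensation if every element of $W(K)$ admits a compensation (in $W(K)$). *)

theory Defs
  imports "HOL-Analysis.Analysis"
begin

text \<open>
  A compact space \<open>K\<close> is a type \<open>'a :: t2_space\<close> with \<^term>\<open>compact (UNIV :: 'a::t2_space set)\<close>. Then every
  continuous real function is bounded, so \<open>'a \<Rightarrow>\<^sub>C real\<close>, whose norm is the supremum norm,
  is \<open>C(K)\<close>.

  A signed measure is a real-valued function on sets. It is required to vanish off the Borel sets,
  so that equality of signed measures is equality of functions.
\<close>

definition signed_borel_measure :: "('a::topological_space set \<Rightarrow> real) \<Rightarrow> bool" where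
  "signed_borel_measure \<mu> \<longleftrightarrow>
     (\<forall>A. A \<notin> sets borel \<longrightarrow> \<mu> A = 0) \<and>
     (\<forall>A::nat \<Rightarrow> 'a set. range A \<subseteq> sets borel \<longrightarrow> disjoint_family A \<longrightarrow>
        (\<lambda>n. \<mu> (A n)) sums \<mu> (\<Union>n. A n))"

text \<open>The Jordan decomposition; the suprema are finite because a real-valued signed measure is
  bounded.\<close>

definition pos_part :: "('a::topological_space set \<Rightarrow> real) \<Rightarrow> 'a set \<Rightarrow> real" where
  "pos_part \<mu> A = (if A \<in> sets borel then SUP B\<in>{B \<in> sets borel. B \<subseteq> A}. \<mu> B else 0)"

definition neg_part :: "('a::topological_space set \<Rightarrow> real) \<Rightarrow> 'a set \<Rightarrow> real" where
  "neg_part \<mu> = pos_part (\<lambda>A. - \<mu> A)"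

definition variation :: "('a::topological_space set \<Rightarrow> real) \<Rightarrow> 'a set \<Rightarrow> real" where
  "variation \<mu> A = pos_part \<mu> A + neg_part \<mu> A"

definition tv_norm :: "('a::topological_space set \<Rightarrow> real) \<Rightarrow> real" where
  "tv_norm \<mu> = variation \<mu> UNIV"

definition signed_integral :: "('a::topological_space set \<Rightarrow> real) \<Rightarrow> ('a \<Rightarrow> real) \<Rightarrow> real" where
  "signed_integral \<mu> g =
     integral\<^sup>L (measure_of UNIV (sets borel) (\<lambda>A. ennreal (pos_part \<mu> A))) g -
     integral\<^sup>L (measure_of UNIV (sets borel) (\<lambda>A. ennreal (neg_part \<mu> A))) g"

definition regular_measures :: "('a::topological_space set \<Rightarrow> real) set" where
  "regular_measures =
     {\<mu>. signed_borel_measure \<mu> \<and>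
         (\<forall>A\<in>sets borel. \<forall>e>0. \<exists>C U. compact C \<and> open U \<and> C \<subseteq> A \<and> A \<subseteq> U \<and>
            variation \<mu> (U - C) < e)}"

definition measure_ball :: "('a::topological_space set \<Rightarrow> real) set" where
  "measure_ball = {\<mu> \<in> regular_measures. tv_norm \<mu> \<le> 1}"

text \<open>The coarsest topology on the regular measures making \<open>\<mu> \<mapsto> \<mu>(g)\<close> continuous for each \<open>g\<close> in
  \<open>C(K)\<close>.\<close>

definition weak_star :: "('a::topological_space set \<Rightarrow> real) topology" where
  "weak_star =
     pullback_topology regular_measures
       (\<lambda>\<mu> (g :: 'a \<Rightarrow>\<^sub>C real). signed_integral \<mu> (apply_bcontfun g))
       (product_topology (\<lambda>_. euclideanreal) UNIV)"

definition pi2 :: "('a::topological_space \<Rightarrow>\<^sub>C real) \<Rightarrow> ('a set \<Rightarrow> real) set" where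
  "pi2 g = {\<mu> \<in> measure_ball. signed_integral \<mu> (apply_bcontfun g) = 1}"

definition pi2_approx :: "('a::topological_space \<Rightarrow>\<^sub>C real) \<Rightarrow> real \<Rightarrow> ('a set \<Rightarrow> real) set" where
  "pi2_approx g \<delta> = {\<mu> \<in> measure_ball. signed_integral \<mu> (apply_bcontfun g) \<ge> 1 - \<delta>}"

definition measure_compensation ::
    "('a::topological_space set \<Rightarrow> real) \<Rightarrow> ('a set \<Rightarrow> real) \<Rightarrow> bool" where
  "measure_compensation \<nu> \<mu> \<longleftrightarrow>
     \<nu> \<in> regular_measures \<and>
     (if \<mu> UNIV > 0
      then (\<forall>A\<in>sets borel. 0 \<le> \<nu> A \<and> \<nu> A \<le> pos_part \<mu> A) \<and> \<nu> UNIV = \<mu> UNIV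
      else \<nu> = (\<lambda>_. 0))"

definition W :: "('a::topological_space \<Rightarrow> 'a set \<Rightarrow> real) set" where
  "W = {F. continuous_map euclidean (subtopology weak_star measure_ball) F}"

definition compensation ::
    "('a::topological_space \<Rightarrow> 'a set \<Rightarrow> real) \<Rightarrow> ('a \<Rightarrow> 'a set \<Rightarrow> real) \<Rightarrow> bool" where
  "compensation G F \<longleftrightarrow> (\<forall>t. measure_compensation (G t) (F t))"

definition admits_local_compensation :: "'a::topological_space itself \<Rightarrow> bool" where
  "admits_local_compensation (_ :: 'a itself) \<longleftrightarrow>
     (\<forall>F\<in>(W :: ('a \<Rightarrow> 'a set \<Rightarrow> real) set). \<exists>G\<in>W. compensation G F)"

end

theory Submission
  imports Defs
begin

text \<open>
  Let \<open>f\<^sub>0\<close> be \<open>f / (1 - \<epsilon>)\<close> truncated to \<open>[-1, 1]\<close>, and let \<open>h\<^sub>1\<close>, \<open>h\<^sub>2\<close> be the positive parts of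
  \<open>(f - (1 - \<epsilon>)) / \<epsilon>\<close> and \<open>(- f - (1 - \<epsilon>)) / \<epsilon>\<close>; these are supported where \<open>f\<^sub>0 = 1\<close> and \<open>f\<^sub>0 = - 1\<close>.
  Let \<open>G\<^sub>1\<close>, \<open>G\<^sub>2\<close> be compensations of \<open>h\<^sub>1 F\<close> and \<open>- h\<^sub>2 F\<close>. Then \<open>s(t) = G\<^sub>1(t)(K) + G\<^sub>2(t)(K)\<close> is
  continuous, and \<open>P = (G\<^sub>1 - G\<^sub>2) / s\<close> takes values in \<open>pi2 f\<^sub>0\<close> wherever \<open>s > 0\<close>. Since
  \<open>G\<^sub>1(t) \<le> F(t)\<^sup>+\<close> and \<open>G\<^sub>2(t) \<le> F(t)\<^sup>-\<close>, we have \<open>\<parallel>P(t) - F(t)\<parallel> \<le> 2 (1 - s(t))\<close>. Finally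
  \<open>1 \<mp> (h\<^sub>1 - h\<^sub>2) \<le> (1 \<mp> f) / \<epsilon>\<close> pointwise, so that \<open>F(t)(f) \<ge> 1 - \<epsilon>\<^sup>2 / 6\<close> forces
  \<open>s(t) \<ge> 1 - \<epsilon> / 6\<close>.
\<close>

section \<open>Hahn and Jordan decompositions\<close>

lemma signed_borel_measure_notin: "signed_borel_measure \<mu> \<Longrightarrow> A \<notin> sets borel \<Longrightarrow> \<mu> A = 0"
  unfolding signed_borel_measure_def by blast

lemma signed_borel_measure_sums:
  fixes A :: "nat \<Rightarrow> 'a::topological_space set"
  assumes "signed_borel_measure \<mu>" "range A \<subseteq> sets borel" "disjoint_family A"
  shows "(\<lambda>n. \<mu> (A n)) sums \<mu> (\<Union>n. A n)"
  using assms unfolding signed_borel_measure_def by blast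

text \<open>The definition does not postulate this value: a constant series converges only if its
  term is zero.\<close>

lemma signed_borel_measure_empty:
  assumes "signed_borel_measure \<mu>"
  shows "\<mu> {} = 0"
proof -
  have "(\<lambda>n::nat. \<mu> {}) sums \<mu> (\<Union>n::nat. {})"
    using signed_borel_measure_sums[OF assms, of "\<lambda>_. {}"] by (auto simp: disjoint_family_on_def)
  then have "summable (\<lambda>n::nat. \<mu> {})" by (rule sums_summable)
  then show ?thesis by (simp add: summable_const_iff)
qed

lemma signed_borel_measure_Un:
  assumes "signed_borel_measure \<mu>" "A \<in> sets borel" "B \<in> sets borel" "A \<inter> B = {}"
  shows "\<mu> (A \<union> B) = \<mu> A + \<mu> B"
proof -
  have "(\<lambda>n. \<mu> (binaryset A B n)) sums \<mu> (\<Union>n. binaryset A B n)"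
    using assms by (intro signed_borel_measure_sums)
      (auto simp: range_binaryset_eq disjoint_family_on_def binaryset_def)
  moreover have "(\<lambda>n. \<mu> (binaryset A B n)) sums (\<mu> A + \<mu> B)"
    by (rule binaryset_sums) (rule signed_borel_measure_empty[OF assms(1)])
  ultimately show ?thesis
    using sums_unique2 by (fastforce simp: UN_binaryset_eq)
qed

lemma signed_borel_measure_Diff:
  assumes "signed_borel_measure \<mu>" "A \<in> sets borel" "B \<in> sets borel" "B \<subseteq> A"
  shows "\<mu> (A - B) = \<mu> A - \<mu> B"
proof -
  have "\<mu> ((A - B) \<union> B) = \<mu> (A - B) + \<mu> B"
    using assms by (intro signed_borel_measure_Un) auto
  moreover have "(A - B) \<union> B = A" using assms by auto
  ultimately show ?thesis by simp
qed

lemma signed_borel_measure_split: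
  assumes "signed_borel_measure \<mu>" "A \<in> sets borel" "P \<in> sets borel"
  shows "\<mu> A = \<mu> (A \<inter> P) + \<mu> (A - P)"
  using signed_borel_measure_Diff[of \<mu> A "A \<inter> P"] assms by (simp add: Diff_Int)

lemma signed_borel_measure_uminus:
  assumes "signed_borel_measure \<mu>"
  shows "signed_borel_measure (\<lambda>A. - \<mu> A)"
  using assms unfolding signed_borel_measure_def by (auto intro: sums_minus)

text \<open>Continuity from above. The successive differences are disjoint and fill up
  \<open>A 0\<close> minus the intersection, so countable additivity turns into a telescoping
  sum.\<close>

lemma signed_borel_measure_decseq:
  fixes A :: "nat \<Rightarrow> 'a::topological_space set"
  assumes \<mu>: "signed_borel_measure \<mu>" and A: "\<And>n. A n \<in> sets borel" and "decseq A"
  shows "(\<lambda>n. \<mu> (A n)) \<longlonglongrightarrow> \<mu> (\<Inter>n. A n)"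
proof -
  define B where "B = (\<lambda>n. A n - A (Suc n))"
  have sub: "A n \<subseteq> A m" if "m \<le> n" for m n
    using \<open>decseq A\<close> that by (rule decseqD)
  have B: "B n \<in> sets borel" for n
    unfolding B_def using A by auto
  have "disjoint_family B"
    unfolding disjoint_family_on_def
  proof safe
    fix m n :: nat and x assume "m \<noteq> n" and x: "x \<in> B m" "x \<in> B n"
    then consider "Suc m \<le> n" | "Suc n \<le> m" by linarith
    then show "x \<in> {}"
      by cases (use x sub in \<open>force simp: B_def\<close>)+
  qed
  moreover have UB: "(\<Union>n. B n) = A 0 - (\<Inter>n. A n)"
  proof (intro equalityI subsetI)
    fix x assume "x \<in> A 0 - (\<Inter>n. A n)"
    then obtain n where n: "x \<notin> A n" "x \<in> A 0" by auto
    \<comment> \<open>The first index at which \<open>x\<close> has left the sequence is a successor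
      because \<open>x \<in> A 0\<close>; its predecessor \<open>m\<close> gives
      \<open>x \<in> B m\<close>.\<close>
    have "\<exists>m<n. (\<forall>i\<le>m. \<not> x \<notin> A i) \<and> x \<notin> A (Suc m)"
      using n ex_least_nat_less[of "\<lambda>n. x \<notin> A n" n] by blast
    then show "x \<in> (\<Union>n. B n)" unfolding B_def by blast
  qed (use sub in \<open>auto simp: B_def\<close>)
  ultimately have "(\<lambda>n. \<mu> (B n)) sums \<mu> (A 0 - (\<Inter>n. A n))"
    using signed_borel_measure_sums[OF \<mu>, of B] B by auto
  moreover have "\<mu> (A 0 - (\<Inter>n. A n)) = \<mu> (A 0) - \<mu> (\<Inter>n. A n)"
    using A by (intro signed_borel_measure_Diff[OF \<mu>]) auto
  moreover have "\<mu> (B n) = \<mu> (A n) - \<mu> (A (Suc n))" for n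
    unfolding B_def using A sub by (intro signed_borel_measure_Diff[OF \<mu>]) auto
  ultimately have "(\<lambda>n. \<mu> (A n) - \<mu> (A (Suc n))) sums (\<mu> (A 0) - \<mu> (\<Inter>n. A n))" by simp
  then have "(\<lambda>n. \<mu> (A 0) - \<mu> (A n)) \<longlonglongrightarrow> \<mu> (A 0) - \<mu> (\<Inter>n. A n)"
    by (simp add: sums_def sum_lessThan_telescope'[of "\<lambda>n. \<mu> (A n)"])
  from tendsto_diff[OF tendsto_const this, of "\<mu> (A 0)"] show ?thesis by simp
qed

text \<open>Otherwise one could remove disjoint sets of measure below \<open>-e\<close> forever.\<close>

lemma ex_almost_positive_subset:
  assumes \<mu>: "signed_borel_measure \<mu>" and D: "D \<in> sets borel" and "e > 0"
  shows "\<exists>A\<in>sets borel. A \<subseteq> D \<and> \<mu> D \<le> \<mu> A \<and> (\<forall>B\<in>sets borel. B \<subseteq> A \<longrightarrow> - e \<le> \<mu> B)"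
proof (rule ccontr)
  assume neg: "\<not> ?thesis"
  define Q where "Q = (\<lambda>A. A \<in> sets borel \<and> A \<subseteq> D \<and> \<mu> D \<le> \<mu> A)"
  have step: "\<exists>A'. Q A' \<and> A' \<subseteq> A \<and> \<mu> (A - A') < - e" if "Q A" for A
  proof -
    have "\<not> (\<forall>B\<in>sets borel. B \<subseteq> A \<longrightarrow> - e \<le> \<mu> B)"
      using neg that unfolding Q_def by blast
    then obtain B where B: "B \<in> sets borel" "B \<subseteq> A" "\<mu> B < - e"
      by (meson not_le)
    have "\<mu> (A - B) = \<mu> A - \<mu> B"
      using that B unfolding Q_def by (intro signed_borel_measure_Diff[OF \<mu>]) auto
    with that B \<open>e > 0\<close> have "Q (A - B)" unfolding Q_def by auto
    moreover have "A - (A - B) = B" using B by auto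
    ultimately show ?thesis using B by (intro exI[of _ "A - B"]) auto
  qed
  have "Q D" using D unfolding Q_def by auto
  have "\<exists>A. \<forall>n::nat. Q (A n) \<and> A (Suc n) \<subseteq> A n \<and> \<mu> (A n - A (Suc n)) < - e"
    using \<open>Q D\<close> step by (intro dependent_nat_choice) auto
  then obtain A where A: "\<And>n::nat. Q (A n)" and dec: "\<And>n. A (Suc n) \<subseteq> A n"
    and lt: "\<And>n. \<mu> (A n - A (Suc n)) < - e" by auto
  have Ab: "A n \<in> sets borel" for n using A unfolding Q_def by auto
  \<comment> \<open>Convergence forces consecutive differences to tend to 0, although each of them
    is below \<open>-e\<close>.\<close>
  have "(\<lambda>n. \<mu> (A n)) \<longlonglongrightarrow> \<mu> (\<Inter>n. A n)"
    using \<mu> Ab dec by (intro signed_borel_measure_decseq decseq_SucI)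
  then have "(\<lambda>n. \<mu> (A n) - \<mu> (A (Suc n))) \<longlonglongrightarrow> \<mu> (\<Inter>n. A n) - \<mu> (\<Inter>n. A n)"
    by (intro tendsto_diff LIMSEQ_Suc)
  moreover have "\<mu> (A n) - \<mu> (A (Suc n)) \<le> - e" for n
    using lt[of n] signed_borel_measure_Diff[OF \<mu> Ab Ab dec, of n] by simp
  ultimately have "\<mu> (\<Inter>n. A n) - \<mu> (\<Inter>n. A n) \<le> - e"
    by (intro LIMSEQ_le_const2) auto
  with \<open>e > 0\<close> show False by simp
qed

definition positive_set :: "('a::topological_space set \<Rightarrow> real) \<Rightarrow> 'a set \<Rightarrow> bool" where
  "positive_set \<mu> A \<longleftrightarrow> A \<in> sets borel \<and> (\<forall>B\<in>sets borel. B \<subseteq> A \<longrightarrow> 0 \<le> \<mu> B)"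

text \<open>Shrinking successively with tolerance \<open>1 / Suc n\<close> never lowers the measure.
  The intersection keeps this bound by continuity from above, and its subsets obey every tolerance
  at once.\<close>

lemma ex_positive_subset:
  assumes \<mu>: "signed_borel_measure \<mu>" and D: "D \<in> sets borel"
  shows "\<exists>A. positive_set \<mu> A \<and> A \<subseteq> D \<and> \<mu> D \<le> \<mu> A"
proof -
  define Q where "Q = (\<lambda>n A. A \<in> sets borel \<and> A \<subseteq> D \<and> \<mu> D \<le> \<mu> A \<and>
    (\<forall>B\<in>sets borel. B \<subseteq> A \<longrightarrow> - (1 / real (Suc n)) \<le> \<mu> B))"
  have step: "\<exists>A'. Q n A' \<and> A' \<subseteq> A" if A: "A \<in> sets borel" "A \<subseteq> D" "\<mu> D \<le> \<mu> A" for n A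
  proof -
    have "0 < 1 / real (Suc n)" by simp
    from ex_almost_positive_subset[OF \<mu> A(1) this] obtain A' where
      "A' \<in> sets borel" "A' \<subseteq> A" "\<mu> A \<le> \<mu> A'"
      "\<forall>B\<in>sets borel. B \<subseteq> A' \<longrightarrow> - (1 / real (Suc n)) \<le> \<mu> B" by blast
    with A show ?thesis unfolding Q_def by (intro exI[of _ A'] conjI) auto
  qed
  have Q: "A \<in> sets borel" "A \<subseteq> D" "\<mu> D \<le> \<mu> A" if "Q n A" for n A
    using that unfolding Q_def by auto
  have "\<exists>A. \<forall>n. Q n (A n) \<and> A (Suc n) \<subseteq> A n"
  proof (rule dependent_nat_choice)
    show "\<exists>A. Q 0 A" using step[OF D, of 0] by auto
    show "\<exists>A'. Q (Suc n) A' \<and> A' \<subseteq> A" if "Q n A" for n A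
      using Q[OF that] by (rule step)
  qed
  then obtain A where A: "\<And>n. Q n (A n)" and dec: "\<And>n. A (Suc n) \<subseteq> A n" by auto
  have Ab: "A n \<in> sets borel" for n using A unfolding Q_def by auto
  have "(\<lambda>n. \<mu> (A n)) \<longlonglongrightarrow> \<mu> (\<Inter>n. A n)"
    using \<mu> Ab dec by (intro signed_borel_measure_decseq decseq_SucI)
  then have "\<mu> D \<le> \<mu> (\<Inter>n. A n)"
    using A unfolding Q_def by (intro LIMSEQ_le_const) auto
  moreover have "0 \<le> \<mu> B" if B: "B \<in> sets borel" "B \<subseteq> (\<Inter>n. A n)" for B
  proof -
    have "- (1 / real (Suc n)) \<le> \<mu> B" for n
    proof -
      have "B \<subseteq> A n" using B by auto
      with A[of n] B(1) show ?thesis unfolding Q_def by blast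
    qed
    moreover have "(\<lambda>n. - (1 / real (Suc n))) \<longlonglongrightarrow> - 0"
      using LIMSEQ_inverse_real_of_nat by (intro tendsto_minus) (simp add: inverse_eq_divide)
    ultimately show ?thesis by (intro LIMSEQ_le_const2[where X="\<lambda>n. - (1 / real (Suc n))"]) auto
  qed
  moreover have "(\<Inter>n. A n) \<subseteq> D" using Q(2)[OF A, of 0] by auto
  ultimately show ?thesis
    using Ab unfolding positive_set_def by (intro exI[of _ "\<Inter>n. A n"]) auto
qed

text \<open>After disjointing the family, a subset \<open>B\<close> of the union splits into
  disjoint pieces, each inside a single \<open>A n\<close> and hence of nonnegative measure.\<close>

lemma positive_set_UN:
  fixes A :: "nat \<Rightarrow> 'a::topological_space set"
  assumes \<mu>: "signed_borel_measure \<mu>" and A: "\<And>n. positive_set \<mu> (A n)"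
  shows "positive_set \<mu> (\<Union>n. A n)"
  unfolding positive_set_def
proof (intro conjI ballI impI)
  have Ab: "A n \<in> sets borel" for n using A unfolding positive_set_def by auto
  then show "(\<Union>n. A n) \<in> sets borel" by auto
  fix B assume B: "B \<in> sets borel" "B \<subseteq> (\<Union>n. A n)"
  have dA: "disjointed A n \<in> sets borel" for n
    using Ab by (meson range_subsetD sets.range_disjointed_sets image_subset_iff)
  have "disjoint_family (\<lambda>n. B \<inter> disjointed A n)"
    using disjoint_family_disjointed[of A] unfolding disjoint_family_on_def by blast
  then have "(\<lambda>n. \<mu> (B \<inter> disjointed A n)) sums \<mu> (\<Union>n. B \<inter> disjointed A n)"
    using dA B by (intro signed_borel_measure_sums[OF \<mu>]) auto
  moreover have "(\<Union>n. B \<inter> disjointed A n) = B"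
    using B(2) UN_disjointed_eq[of A] by auto
  ultimately have S: "(\<lambda>n. \<mu> (B \<inter> disjointed A n)) sums \<mu> B" by simp
  have nonneg: "0 \<le> \<mu> (B \<inter> disjointed A n)" for n
  proof -
    have "B \<inter> disjointed A n \<in> sets borel" "B \<inter> disjointed A n \<subseteq> A n"
      using dA B(1) disjointed_subset[of A n] by auto
    with A[of n] show ?thesis unfolding positive_set_def by blast
  qed
  show "0 \<le> \<mu> B" by (rule sums_le[OF nonneg sums_zero S])
qed

lemma positive_set_mono:
  assumes "signed_borel_measure \<mu>" "positive_set \<mu> B" "A \<in> sets borel" "A \<subseteq> B"
  shows "\<mu> A \<le> \<mu> B"
proof -
  have "0 \<le> \<mu> (B - A)" using assms unfolding positive_set_def by auto
  then show ?thesis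
    using signed_borel_measure_Diff[of \<mu> B A] assms unfolding positive_set_def by auto
qed

text \<open>A maximizing sequence of positive sets has a positive union \<open>P\<close> of maximal
  measure. A set of positive measure off \<open>P\<close> would contain a positive set that could be
  added to \<open>P\<close>, exceeding the maximum.\<close>

theorem Hahn_decomposition:
  assumes \<mu>: "signed_borel_measure \<mu>"
  shows "\<exists>P. positive_set \<mu> P \<and> positive_set (\<lambda>A. - \<mu> A) (- P)"
proof -
  define S where "S = \<mu> ` {A. positive_set \<mu> A}"
  have S_ne: "S \<noteq> {}"
    unfolding S_def using ex_positive_subset[OF \<mu>, of "{}"] by auto
  have ex_ub: "\<exists>P. positive_set \<mu> P \<and> (\<forall>n. \<mu> (A n) \<le> \<mu> P)"
    if "\<And>n. positive_set \<mu> (A n)" for A :: "nat \<Rightarrow> _"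
  proof (intro exI[of _ "\<Union>n. A n"] conjI allI)
    show pos: "positive_set \<mu> (\<Union>n. A n)" by (rule positive_set_UN[OF \<mu> that])
    show "\<mu> (A n) \<le> \<mu> (\<Union>n. A n)" for n
    proof (rule positive_set_mono[OF \<mu> pos])
      show "A n \<in> sets borel" using that[of n] unfolding positive_set_def by simp
    qed auto
  qed
  \<comment> \<open>If the values were unbounded, the union of suitable positive sets would have a
    real measure above every natural number.\<close>
  have bdd: "bdd_above S"
  proof (rule ccontr)
    assume "\<not> bdd_above S"
    then have "\<forall>n::nat. \<exists>A. positive_set \<mu> A \<and> real n < \<mu> A"
      unfolding S_def bdd_above_def by (auto simp: not_le)
    then obtain A where A: "\<And>n::nat. positive_set \<mu> (A n)" "\<And>n. real n < \<mu> (A n)" by metis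
    obtain P where P: "\<And>n. \<mu> (A n) \<le> \<mu> P" using ex_ub[of A, OF A(1)] by auto
    obtain n where "\<mu> P < real n" using reals_Archimedean2 by blast
    with A(2)[of n] P[of n] show False by simp
  qed
  have "\<forall>n::nat. \<exists>A. positive_set \<mu> A \<and> Sup S - 1 / real (Suc n) < \<mu> A"
  proof
    fix n :: nat
    have "\<exists>y\<in>S. Sup S - 1 / real (Suc n) < y"
      unfolding less_cSup_iff[OF S_ne bdd, symmetric] by simp
    then show "\<exists>A. positive_set \<mu> A \<and> Sup S - 1 / real (Suc n) < \<mu> A" unfolding S_def by auto
  qed
  then obtain A where A: "\<And>n::nat. positive_set \<mu> (A n)"
    "\<And>n. Sup S - 1 / real (Suc n) < \<mu> (A n)" by metis
  obtain P where P: "positive_set \<mu> P" "\<And>n. \<mu> (A n) \<le> \<mu> P" using ex_ub[of A, OF A(1)] by auto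
  have "(\<lambda>n. Sup S - 1 / real (Suc n)) \<longlonglongrightarrow> Sup S - 0"
    using LIMSEQ_inverse_real_of_nat
    by (intro tendsto_diff tendsto_const) (simp add: inverse_eq_divide)
  moreover have "Sup S - 1 / real (Suc n) \<le> \<mu> P" for n
    using A(2)[of n] P(2)[of n] by linarith
  ultimately have "Sup S - 0 \<le> \<mu> P" by (intro LIMSEQ_le_const2) auto
  then have SupP: "Sup S \<le> \<mu> P" by simp
  have Pb: "P \<in> sets borel" using P(1) unfolding positive_set_def by auto
  have "\<mu> D \<le> 0" if D: "D \<in> sets borel" "D \<subseteq> - P" for D
  proof -
    obtain A where A: "positive_set \<mu> A" "A \<subseteq> D" "\<mu> D \<le> \<mu> A"
      using ex_positive_subset[OF \<mu> D(1)] by auto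
    \<comment> \<open>The union of two sets is written as a sequence so that the countable case
      applies.\<close>
    have "positive_set \<mu> (\<Union>n::nat. if n = 0 then A else P)"
      using A P by (intro positive_set_UN[OF \<mu>]) auto
    moreover have "(\<Union>n::nat. if n = 0 then A else P) = A \<union> P" by (auto split: if_splits)
    ultimately have "\<mu> (A \<union> P) \<in> S" unfolding S_def by auto
    then have "\<mu> (A \<union> P) \<le> \<mu> P" using cSup_upper[OF _ bdd] SupP by fastforce
    moreover have "\<mu> (A \<union> P) = \<mu> A + \<mu> P"
      using A D Pb unfolding positive_set_def by (intro signed_borel_measure_Un[OF \<mu>]) auto
    ultimately show ?thesis using A by simp
  qed
  then show ?thesis
    using P(1) Pb unfolding positive_set_def by (intro exI[of _ P]) auto
qed

section \<open>Passage from set functions to measures, and the Jordan decomposition\<close>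

definition borel_measure_of :: "('a::topological_space set \<Rightarrow> real) \<Rightarrow> 'a measure" where
  "borel_measure_of \<nu> = measure_of UNIV (sets borel) (\<lambda>A. ennreal (\<nu> A))"

lemma
  shows sets_borel_measure_of [simp]: "sets (borel_measure_of \<nu>) = sets borel"
    and space_borel_measure_of [simp]: "space (borel_measure_of \<nu>) = UNIV"
  unfolding borel_measure_of_def
  using sets.sigma_sets_eq[of borel] by (auto simp: sets_measure_of_conv space_measure_of_conv)

lemma
  assumes \<mu>: "signed_borel_measure \<mu>" and pos: "\<And>A. A \<in> sets borel \<Longrightarrow> 0 \<le> \<mu> A"
  shows finite_measure_borel_measure_of: "finite_measure (borel_measure_of \<mu>)"
    and measure_borel_measure_of: "measure (borel_measure_of \<mu>) = \<mu>"
proof -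
  have em: "emeasure (borel_measure_of \<mu>) A = ennreal (\<mu> A)" if "A \<in> sets borel" for A
    unfolding borel_measure_of_def
  proof (rule emeasure_measure_of_sigma[OF _ _ _ that])
    show "sigma_algebra UNIV (sets borel)"
      using sets.sigma_algebra_axioms[of borel] by simp
    show "positive (sets borel) (\<lambda>A. ennreal (\<mu> A))"
      by (simp add: positive_def signed_borel_measure_empty[OF \<mu>])
    show "countably_additive (sets borel) (\<lambda>A. ennreal (\<mu> A))"
      unfolding countably_additive_def
    proof (intro allI impI)
      fix A :: "nat \<Rightarrow> 'a set" assume A: "range A \<subseteq> sets borel" "disjoint_family A"
      have "0 \<le> \<mu> (A n)" for n using A(1) by (intro pos) auto
      then show "(\<Sum>n. ennreal (\<mu> (A n))) = ennreal (\<mu> (\<Union>n. A n))"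
        using signed_borel_measure_sums[OF \<mu> A] by (rule suminf_ennreal_eq)
    qed
  qed
  then show "finite_measure (borel_measure_of \<mu>)"
    by (intro finite_measureI) simp
  show "measure (borel_measure_of \<mu>) = \<mu>"
  proof
    fix A
    show "measure (borel_measure_of \<mu>) A = \<mu> A"
      by (cases "A \<in> sets borel")
        (auto simp: measure_def em pos measure_notin_sets signed_borel_measure_notin[OF \<mu>]
          emeasure_notin_sets)
  qed
qed

text \<open>The supremum is attained at \<open>A \<inter> P\<close>: discarding the part of
  \<open>B\<close> off \<open>P\<close> and then enlarging the rest to \<open>A \<inter> P\<close>
  can only increase the value.\<close>

lemma pos_part_eq:
  assumes \<mu>: "signed_borel_measure \<mu>" and P: "positive_set \<mu> P" "positive_set (\<lambda>A. - \<mu> A) (- P)"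
  shows "pos_part \<mu> = (\<lambda>A. if A \<in> sets borel then \<mu> (A \<inter> P) else 0)"
proof
  fix A
  have Pb: "P \<in> sets borel" using P(1) unfolding positive_set_def by auto
  show "pos_part \<mu> A = (if A \<in> sets borel then \<mu> (A \<inter> P) else 0)"
  proof (cases "A \<in> sets borel")
    case True
    have "\<mu> B \<le> \<mu> (A \<inter> P)" if "B \<in> sets borel" "B \<subseteq> A" for B
    proof -
      have "\<mu> B = \<mu> (B \<inter> P) + \<mu> (B - P)"
        using that Pb by (intro signed_borel_measure_split[OF \<mu>])
      moreover have "0 \<le> - \<mu> (B - P)"
        using P(2) that Pb unfolding positive_set_def by blast
      moreover have "positive_set \<mu> (A \<inter> P)"
        using P(1) True unfolding positive_set_def by auto
      then have "\<mu> (B \<inter> P) \<le> \<mu> (A \<inter> P)"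
        using that Pb by (intro positive_set_mono[OF \<mu>]) auto
      ultimately show ?thesis by simp
    qed
    then have "(SUP B\<in>{B \<in> sets borel. B \<subseteq> A}. \<mu> B) = \<mu> (A \<inter> P)"
      using True Pb by (intro cSup_eq_maximum) auto
    then show ?thesis using True by (simp add: pos_part_def)
  qed (simp add: pos_part_def)
qed

text \<open>The case distinction restores the value 0 off the Borel sets, since
  \<open>A \<inter> P\<close> may be Borel when \<open>A\<close> is not.\<close>

lemma signed_borel_measure_restrict:
  assumes \<mu>: "signed_borel_measure \<mu>" and P: "P \<in> sets borel"
  shows "signed_borel_measure (\<lambda>A. if A \<in> sets borel then \<mu> (A \<inter> P) else 0)"
  unfolding signed_borel_measure_def
proof (intro conjI allI impI)
  fix A :: "nat \<Rightarrow> 'a set" assume A: "range A \<subseteq> sets borel" "disjoint_family A"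
  have "(\<lambda>n. \<mu> (A n \<inter> P)) sums \<mu> (\<Union>n. A n \<inter> P)"
    using A P by (intro signed_borel_measure_sums[OF \<mu>]) (auto simp: disjoint_family_on_def)
  moreover have "A n \<in> sets borel" "(\<Union>n. A n) \<in> sets borel" for n using A by auto
  ultimately show "(\<lambda>n. if A n \<in> sets borel then \<mu> (A n \<inter> P) else 0) sums
      (if (\<Union>n. A n) \<in> sets borel then \<mu> ((\<Union>n. A n) \<inter> P) else 0)"
    by (simp add: Int_UN_distrib2)
qed auto

definition finite_borel :: "'a::topological_space measure \<Rightarrow> bool" where
  "finite_borel M \<longleftrightarrow> finite_measure M \<and> sets M = sets borel"

text \<open>The interface through which later proofs treat signed measures: every estimate is
  reduced to the finite measures \<open>M\<close> and \<open>N\<close>. The integral formula holds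
  for all \<open>g\<close> because these are the very measures in the definition of
  \<open>signed_integral\<close>.\<close>

theorem Jordan_decomposition:
  assumes \<mu>: "signed_borel_measure \<mu>"
  shows "\<exists>M N. finite_borel M \<and> finite_borel N \<and> measure M = pos_part \<mu> \<and> measure N = neg_part \<mu> \<and>
    \<mu> = (\<lambda>A. measure M A - measure N A) \<and>
    (\<forall>g. signed_integral \<mu> g = integral\<^sup>L M g - integral\<^sup>L N g)"
proof -
  obtain P where P: "positive_set \<mu> P" "positive_set (\<lambda>A. - \<mu> A) (- P)"
    using Hahn_decomposition[OF \<mu>] by auto
  have Pb: "P \<in> sets borel" using P(1) unfolding positive_set_def by auto
  have nP: "neg_part \<mu> = (\<lambda>A. if A \<in> sets borel then - \<mu> (A \<inter> - P) else 0)"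
    unfolding neg_part_def using P by (intro pos_part_eq signed_borel_measure_uminus[OF \<mu>]) auto
  note pP = pos_part_eq[OF \<mu> P]
  have p: "signed_borel_measure (pos_part \<mu>)" "\<And>A. A \<in> sets borel \<Longrightarrow> 0 \<le> pos_part \<mu> A"
    unfolding pP using P(1) signed_borel_measure_restrict[OF \<mu> Pb]
    by (auto simp: positive_set_def)
  have n: "signed_borel_measure (neg_part \<mu>)" "\<And>A. A \<in> sets borel \<Longrightarrow> 0 \<le> neg_part \<mu> A"
    unfolding nP using P(2) Pb
      signed_borel_measure_restrict[OF signed_borel_measure_uminus[OF \<mu>], of "- P"]
    by (auto simp: positive_set_def)
  have diff: "\<mu> = (\<lambda>A. pos_part \<mu> A - neg_part \<mu> A)"
    using signed_borel_measure_split[OF \<mu> _ Pb] signed_borel_measure_notin[OF \<mu>]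
    unfolding pP nP Diff_eq by (intro ext) simp
  show ?thesis
  proof (rule exI[of _ "borel_measure_of (pos_part \<mu>)"], rule exI[of _ "borel_measure_of (neg_part \<mu>)"],
      intro conjI allI)
    show "\<mu> = (\<lambda>A. measure (borel_measure_of (pos_part \<mu>)) A - measure (borel_measure_of (neg_part \<mu>)) A)"
      using diff measure_borel_measure_of[OF p] measure_borel_measure_of[OF n] by simp
    show "signed_integral \<mu> g =
        integral\<^sup>L (borel_measure_of (pos_part \<mu>)) g - integral\<^sup>L (borel_measure_of (neg_part \<mu>)) g" for g
      unfolding signed_integral_def borel_measure_of_def ..
  qed (use p n in \<open>simp_all add: finite_borel_def finite_measure_borel_measure_of measure_borel_measure_of\<close>)
qed

section \<open>Differences of finite Borel measures\<close>

lemma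
  assumes "finite_borel M"
  shows finite_borel_finite: "finite_measure M"
    and finite_borel_sets: "sets M = sets borel"
    and finite_borel_space: "space M = UNIV"
    and borel_measurable_finite_borel: "borel_measurable M = borel_measurable borel"
proof -
  show "finite_measure M" and sets: "sets M = sets borel"
    using assms unfolding finite_borel_def by auto
  show "space M = UNIV" using sets_eq_imp_space_eq[OF sets] by simp
  show "borel_measurable M = borel_measurable borel"
    by (rule measurable_cong_sets[OF sets refl])
qed

lemma finite_borel_mono:
  assumes "finite_borel M" "A \<in> sets borel" "B \<in> sets borel" "A \<subseteq> B"
  shows "measure M A \<le> measure M B"
  using assms finite_measure.finite_measure_mono[OF finite_borel_finite, of M A B]
  by (simp add: finite_borel_sets)

lemma finite_borel_integrable:
  fixes g :: "'a::topological_space \<Rightarrow> real"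
  assumes "finite_borel M" "g \<in> borel_measurable borel" "\<And>x. \<bar>g x\<bar> \<le> K"
  shows "integrable M g"
proof (rule finite_measure.integrable_const_bound[OF finite_borel_finite[OF assms(1)]])
  show "AE x in M. norm (g x) \<le> K" using assms(3) by simp
  show "g \<in> borel_measurable M"
    unfolding borel_measurable_finite_borel[OF assms(1)] by (rule assms(2))
qed

lemma borel_measurable_bcontfun [measurable]:
  "apply_bcontfun (g :: 'a::topological_space \<Rightarrow>\<^sub>C real) \<in> borel_measurable borel"
  by (intro borel_measurable_continuous_onI) simp

lemma abs_bcontfun_le: "\<bar>apply_bcontfun g x\<bar> \<le> norm (g :: 'a::topological_space \<Rightarrow>\<^sub>C real)"
  using norm_bounded[of g x] by simp

lemma integrable_bcontfun:
  fixes g :: "'a::topological_space \<Rightarrow>\<^sub>C real"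
  assumes "finite_borel M"
  shows "integrable M g"
  using assms borel_measurable_bcontfun abs_bcontfun_le by (rule finite_borel_integrable)

text \<open>The identity \<open>M - N = M' - N'\<close> is stated with sums because subtraction does
  not cancel well in \<open>ennreal\<close>. It passes from indicators to all nonnegative Borel
  functions by linearity and monotone convergence.\<close>

lemma nn_integral_add_measures_eq:
  fixes h :: "'a::topological_space \<Rightarrow> ennreal"
  assumes fb: "finite_borel M" "finite_borel N" "finite_borel M'" "finite_borel N'"
    and eq: "\<And>A. A \<in> sets borel \<Longrightarrow> measure M A + measure N' A = measure M' A + measure N A"
    and h: "h \<in> borel_measurable borel"
  shows "integral\<^sup>N M h + integral\<^sup>N N' h = integral\<^sup>N M' h + integral\<^sup>N N h"
  using h
proof (induction rule: borel_measurable_induct)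
  case (cong f g)
  then have "f = g" by auto
  then show ?case using cong by simp
next
  case (set A)
  have em: "emeasure L A = ennreal (measure L A)" if "finite_borel L" for L
    using finite_measure.emeasure_eq_measure[OF finite_borel_finite[OF that]] .
  show ?case
    using set fb eq[OF set] by (simp add: finite_borel_sets em ennreal_plus[symmetric] del: ennreal_plus)
next
  case (mult u c)
  then show ?case
    using fb by (simp add: nn_integral_cmult borel_measurable_finite_borel[where ?'b=ennreal] flip: distrib_left)
next
  case (add u v)
  then have "integral\<^sup>N L (\<lambda>x. v x + u x) = integral\<^sup>N L v + integral\<^sup>N L u" if "finite_borel L" for L
    using that by (intro nn_integral_add) (auto simp: borel_measurable_finite_borel)
  with fb add.IH show ?case by (simp add: ac_simps)
next
  case (seq U)
  have mc: "integral\<^sup>N L (SUP i. U i) = (SUP i. integral\<^sup>N L (U i))" if "finite_borel L" for L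
    unfolding SUP_apply[abs_def] using seq that
    by (intro nn_integral_monotone_convergence_SUP) (auto simp: borel_measurable_finite_borel)
  have inc: "incseq (\<lambda>i. integral\<^sup>N L (U i))" for L
    using \<open>incseq U\<close> by (auto simp: incseq_def le_fun_def intro!: nn_integral_mono)
  show ?case
    unfolding fb[THEN mc] ennreal_SUP_add[OF inc inc, symmetric] seq.IH ..
qed

lemma integral_add_measures_eq:
  fixes g :: "'a::topological_space \<Rightarrow> real"
  assumes fb: "finite_borel M" "finite_borel N" "finite_borel M'" "finite_borel N'"
    and eq: "\<And>A. A \<in> sets borel \<Longrightarrow> measure M A + measure N' A = measure M' A + measure N A"
    and g: "g \<in> borel_measurable borel" and K: "\<And>x. \<bar>g x\<bar> \<le> K"
  shows "integral\<^sup>L M g + integral\<^sup>L N' g = integral\<^sup>L M' g + integral\<^sup>L N g"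
proof -
  \<comment> \<open>Adding the bound \<open>K\<close> makes the integrand nonnegative; the extra
    terms \<open>K * measure L UNIV\<close> cancel at the end by \<open>eq\<close> on the whole
    space.\<close>
  have nonneg: "0 \<le> g x + K" for x using K[of x] by linarith
  have *: "integral\<^sup>N L (\<lambda>x. ennreal (g x + K)) = ennreal (integral\<^sup>L L g + K * measure L UNIV)"
      "0 \<le> integral\<^sup>L L g + K * measure L UNIV"
    if L: "finite_borel L" for L
  proof -
    have int: "integrable L g" "integrable L (\<lambda>x. K)"
      using finite_borel_integrable[OF L g K] finite_borel_integrable[OF L, of "\<lambda>_. K" "\<bar>K\<bar>"]
      by auto
    then have "integral\<^sup>L L (\<lambda>x. g x + K) = integral\<^sup>L L g + K * measure L UNIV"
      by (simp add: finite_borel_space[OF L])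
    moreover have "integral\<^sup>N L (\<lambda>x. ennreal (g x + K)) = ennreal (integral\<^sup>L L (\<lambda>x. g x + K))"
      using int nonneg by (intro nn_integral_eq_integral) auto
    moreover have "0 \<le> integral\<^sup>L L (\<lambda>x. g x + K)"
      using nonneg by (intro integral_nonneg_AE) auto
    ultimately show "integral\<^sup>N L (\<lambda>x. ennreal (g x + K)) = ennreal (integral\<^sup>L L g + K * measure L UNIV)"
      "0 \<le> integral\<^sup>L L g + K * measure L UNIV" by simp_all
  qed
  have "(\<lambda>x. ennreal (g x + K)) \<in> borel_measurable borel" using g by measurable
  from nn_integral_add_measures_eq[OF fb eq this]
  have "ennreal (integral\<^sup>L M g + K * measure M UNIV + (integral\<^sup>L N' g + K * measure N' UNIV))
      = ennreal (integral\<^sup>L M' g + K * measure M' UNIV + (integral\<^sup>L N g + K * measure N UNIV))"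
    using fb by (simp add: *)
  then have "integral\<^sup>L M g + K * measure M UNIV + (integral\<^sup>L N' g + K * measure N' UNIV)
      = integral\<^sup>L M' g + K * measure M' UNIV + (integral\<^sup>L N g + K * measure N UNIV)"
    using *(2) fb by (subst (asm) ennreal_inj) (auto intro!: add_nonneg_nonneg)
  moreover have "K * measure M UNIV + K * measure N' UNIV = K * measure M' UNIV + K * measure N UNIV"
    using eq[of UNIV] by (simp add: distrib_left[symmetric])
  ultimately show ?thesis by linarith
qed

lemma signed_borel_measure_measure_diff:
  assumes "finite_borel M" "finite_borel N"
  shows "signed_borel_measure (\<lambda>A. measure M A - measure N A)"
  unfolding signed_borel_measure_def
proof (intro conjI allI impI)
  fix A :: "'a set" assume "A \<notin> sets borel"
  then show "measure M A - measure N A = 0"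
    using assms by (simp add: measure_notin_sets finite_borel_sets)
next
  fix A :: "nat \<Rightarrow> 'a set" assume A: "range A \<subseteq> sets borel" "disjoint_family A"
  have "(\<lambda>n. measure L (A n)) sums measure L (\<Union>n. A n)" if "finite_borel L" for L
    using A that finite_measure.finite_measure_UNION[OF finite_borel_finite, of L A]
    by (simp add: finite_borel_sets)
  with assms show "(\<lambda>n. measure M (A n) - measure N (A n)) sums
      (measure M (\<Union>n. A n) - measure N (\<Union>n. A n))"
    by (intro sums_diff) auto
qed

text \<open>The integral may be computed from any representation as a difference of finite measures.
  Densities and rescalings can thus be used without showing that they form the Jordan
  decomposition.\<close>

lemma signed_integral_measure_diff:
  fixes g :: "'a::topological_space \<Rightarrow> real"
  assumes fb: "finite_borel M" "finite_borel N"
    and g: "g \<in> borel_measurable borel" and K: "\<And>x. \<bar>g x\<bar> \<le> K"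
  shows "signed_integral (\<lambda>A. measure M A - measure N A) g = integral\<^sup>L M g - integral\<^sup>L N g"
proof -
  obtain M' N' where fb': "finite_borel M'" "finite_borel N'"
    and eq: "(\<lambda>A. measure M A - measure N A) = (\<lambda>A. measure M' A - measure N' A)"
    and int: "\<And>g. signed_integral (\<lambda>A. measure M A - measure N A) g = integral\<^sup>L M' g - integral\<^sup>L N' g"
    using Jordan_decomposition[OF signed_borel_measure_measure_diff[OF fb]] by blast
  have "measure M A + measure N' A = measure M' A + measure N A" for A
    using fun_cong[OF eq, of A] by simp
  from integral_add_measures_eq[OF fb fb' this g K] show ?thesis unfolding int by simp
qed

section \<open>Estimates for the variation, regularity by domination, and weak* continuity\<close>

lemma pos_part_le:
  assumes "A \<in> sets borel" "\<And>B. B \<in> sets borel \<Longrightarrow> B \<subseteq> A \<Longrightarrow> \<mu> B \<le> c"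
  shows "pos_part \<mu> A \<le> c"
proof -
  have "(SUP B\<in>{B \<in> sets borel. B \<subseteq> A}. \<mu> B) \<le> c"
    using assms by (intro cSUP_least) auto
  then show ?thesis using assms by (simp add: pos_part_def)
qed

lemma variation_le:
  assumes "A \<in> sets borel" "\<And>B. B \<in> sets borel \<Longrightarrow> B \<subseteq> A \<Longrightarrow> \<mu> B \<le> a"
    "\<And>B. B \<in> sets borel \<Longrightarrow> B \<subseteq> A \<Longrightarrow> - \<mu> B \<le> b"
  shows "variation \<mu> A \<le> a + b"
  unfolding variation_def neg_part_def using assms by (intro add_mono pos_part_le) auto

lemma pos_part_measure_diff_le:
  assumes "finite_borel M" "finite_borel N" "A \<in> sets borel"
  shows "pos_part (\<lambda>A. measure M A - measure N A) A \<le> measure M A"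
proof (rule pos_part_le[OF assms(3)])
  fix B :: "'a set" assume "B \<in> sets borel" "B \<subseteq> A"
  with assms show "measure M B - measure N B \<le> measure M A"
    using finite_borel_mono[of M B A] measure_nonneg[of N B] by linarith
qed

lemma variation_measure_diff_le:
  assumes "finite_borel M" "finite_borel N" "A \<in> sets borel"
  shows "variation (\<lambda>A. measure M A - measure N A) A \<le> measure M A + measure N A"
  using pos_part_measure_diff_le[OF assms] pos_part_measure_diff_le[OF assms(2,1,3)]
  by (simp add: variation_def neg_part_def)

lemma abs_le_variation:
  assumes "signed_borel_measure \<mu>"
  shows "\<bar>\<mu> A\<bar> \<le> variation \<mu> A"
proof -
  obtain M N where M: "measure M = pos_part \<mu>" and N: "measure N = neg_part \<mu>"
    and eq: "\<mu> = (\<lambda>A. measure M A - measure N A)"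
    using Jordan_decomposition[OF assms] by blast
  have "\<mu> A = pos_part \<mu> A - neg_part \<mu> A" using fun_cong[OF eq, of A] unfolding M N .
  moreover have "0 \<le> pos_part \<mu> A" "0 \<le> neg_part \<mu> A"
    unfolding M[symmetric] N[symmetric] by simp_all
  ultimately show ?thesis unfolding variation_def by linarith
qed

lemma variation_mono:
  assumes "signed_borel_measure \<mu>" "A \<in> sets borel" "B \<in> sets borel" "A \<subseteq> B"
  shows "variation \<mu> A \<le> variation \<mu> B"
proof -
  obtain M N where M: "finite_borel M" "measure M = pos_part \<mu>"
    and N: "finite_borel N" "measure N = neg_part \<mu>"
    using Jordan_decomposition[OF assms(1)] by blast
  show ?thesis
    unfolding variation_def M(2)[symmetric] N(2)[symmetric]
    using M(1) N(1) assms(2-4) by (intro add_mono finite_borel_mono)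
qed

lemma variation_uminus: "variation (\<lambda>A. - \<mu> A) = variation \<mu>"
  by (rule ext) (simp add: variation_def neg_part_def)

lemma signed_integral_uminus: "signed_integral (\<lambda>A. - \<mu> A) g = - signed_integral \<mu> g"
  by (simp add: signed_integral_def neg_part_def)

lemma regular_measures_signed: "\<mu> \<in> regular_measures \<Longrightarrow> signed_borel_measure \<mu>"
  unfolding regular_measures_def by simp

lemma regular_measures_uminus: "\<mu> \<in> regular_measures \<Longrightarrow> (\<lambda>A. - \<mu> A) \<in> regular_measures"
  unfolding regular_measures_def by (simp add: variation_uminus signed_borel_measure_uminus)

text \<open>Intersecting the open sets and uniting the compact sets of \<open>\<nu>\<^sub>1\<close>
  and \<open>\<nu>\<^sub>2\<close> approximates \<open>A\<close> for both at once. Two dominating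
  measures are allowed because a normalized difference of two compensations is dominated by the
  pair.\<close>

lemma regular_measures_dominated:
  fixes \<mu> :: "'a::t2_space set \<Rightarrow> real"
  assumes \<mu>: "signed_borel_measure \<mu>" and reg: "\<nu>\<^sub>1 \<in> regular_measures" "\<nu>\<^sub>2 \<in> regular_measures"
    and "c > 0" and le: "\<And>A. A \<in> sets borel \<Longrightarrow> variation \<mu> A \<le> c * (variation \<nu>\<^sub>1 A + variation \<nu>\<^sub>2 A)"
  shows "\<mu> \<in> regular_measures"
  unfolding regular_measures_def
proof (intro CollectI conjI \<mu> ballI allI impI)
  fix A :: "'a set" and e :: real assume A: "A \<in> sets borel" and "e > 0"
  \<comment> \<open>Two variations below this bound add up to less than \<open>e / c\<close>, which
    absorbs the factor \<open>c\<close>.\<close>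
  then have e: "e / (2 * c) > 0" using \<open>c > 0\<close> by simp
  obtain C\<^sub>1 U\<^sub>1 where 1: "compact C\<^sub>1" "open U\<^sub>1" "C\<^sub>1 \<subseteq> A" "A \<subseteq> U\<^sub>1" "variation \<nu>\<^sub>1 (U\<^sub>1 - C\<^sub>1) < e / (2 * c)"
    using reg(1) A e unfolding regular_measures_def by blast
  obtain C\<^sub>2 U\<^sub>2 where 2: "compact C\<^sub>2" "open U\<^sub>2" "C\<^sub>2 \<subseteq> A" "A \<subseteq> U\<^sub>2" "variation \<nu>\<^sub>2 (U\<^sub>2 - C\<^sub>2) < e / (2 * c)"
    using reg(2) A e unfolding regular_measures_def by blast
  let ?D = "U\<^sub>1 \<inter> U\<^sub>2 - (C\<^sub>1 \<union> C\<^sub>2)"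
  have b: "U - C \<in> sets borel" if "compact C" "open U" for U C :: "'a set"
    using that by (intro sets.Diff) (auto intro: borel_compact)
  have D: "?D \<in> sets borel" using 1 2 by (intro b) auto
  have "variation \<nu>\<^sub>1 ?D \<le> variation \<nu>\<^sub>1 (U\<^sub>1 - C\<^sub>1)"
    using 1 2 D by (intro variation_mono regular_measures_signed reg b) auto
  moreover have "variation \<nu>\<^sub>2 ?D \<le> variation \<nu>\<^sub>2 (U\<^sub>2 - C\<^sub>2)"
    using 1 2 D by (intro variation_mono regular_measures_signed reg b) auto
  ultimately have "variation \<nu>\<^sub>1 ?D + variation \<nu>\<^sub>2 ?D < e / c"
    using 1 2 by (simp add: field_simps)
  then have "c * (variation \<nu>\<^sub>1 ?D + variation \<nu>\<^sub>2 ?D) < e"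
    using \<open>c > 0\<close> by (simp add: field_simps)
  with le[OF D] have "variation \<mu> ?D < e" by linarith
  then show "\<exists>C U. compact C \<and> open U \<and> C \<subseteq> A \<and> A \<subseteq> U \<and> variation \<mu> (U - C) < e"
    using 1 2 by (intro exI[of _ "C\<^sub>1 \<union> C\<^sub>2"] exI[of _ "U\<^sub>1 \<inter> U\<^sub>2"]) auto
qed

text \<open>The universal property of the pullback topology: weak* continuity is tested on one
  \<open>g\<close> at a time.\<close>

lemma continuous_map_weak_star:
  fixes F :: "'b \<Rightarrow> 'a::topological_space set \<Rightarrow> real"
  shows "continuous_map X weak_star F \<longleftrightarrow> F \<in> topspace X \<rightarrow> regular_measures \<and>
    (\<forall>g :: 'a \<Rightarrow>\<^sub>C real. continuous_map X euclideanreal (\<lambda>t. signed_integral (F t) g))"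
    (is "?L \<longleftrightarrow> ?R")
proof
  assume L: ?L
  have "continuous_map weak_star (product_topology (\<lambda>_. euclideanreal) UNIV)
      (id \<circ> (\<lambda>\<mu> (g :: 'a \<Rightarrow>\<^sub>C real). signed_integral \<mu> g))"
    unfolding weak_star_def by (intro continuous_map_pullback continuous_map_id)
  from continuous_map_compose[OF L this]
  have "\<forall>g :: 'a \<Rightarrow>\<^sub>C real. continuous_map X euclideanreal (\<lambda>t. signed_integral (F t) g)"
    by (simp add: continuous_map_componentwise_UNIV o_def)
  moreover have "topspace (weak_star :: ('a set \<Rightarrow> real) topology) \<subseteq> regular_measures"
    unfolding weak_star_def topspace_pullback_topology by auto
  then have "F \<in> topspace X \<rightarrow> regular_measures"
    using continuous_map_image_subset_topspace[OF L] by auto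
  ultimately show ?R by blast
next
  assume R: ?R
  then have "continuous_map X (product_topology (\<lambda>_. euclideanreal) UNIV)
      ((\<lambda>\<mu> (g :: 'a \<Rightarrow>\<^sub>C real). signed_integral \<mu> g) \<circ> F)"
    by (simp add: continuous_map_componentwise_UNIV o_def)
  then show ?L
    unfolding weak_star_def using R by (intro continuous_map_pullback') auto
qed

section \<open>Multiplication by a continuous function and rescaling\<close>

text \<open>The measure \<open>h M\<close> stays below \<open>M\<close>, ignores the zero set of
  \<open>h\<close>, and has as total mass the integral of \<open>h\<close>, so that after the cutoff
  the mass is given by integrating a continuous function.\<close>

lemma
  fixes h :: "'a::topological_space \<Rightarrow>\<^sub>C real"
  assumes M: "finite_borel M" and h: "\<And>x. 0 \<le> h x" "\<And>x. h x \<le> 1"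
  shows finite_borel_density: "finite_borel (density M h)"
    and measure_density_le: "A \<in> sets borel \<Longrightarrow> measure (density M h) A \<le> measure M A"
    and measure_density_zero: "measure (density M h) {x. h x = 0} = 0"
    and integral_density_bcontfun:
      "\<And>g :: 'a \<Rightarrow>\<^sub>C real. integral\<^sup>L (density M h) g = integral\<^sup>L M (\<lambda>x. h x * g x)"
    and measure_density_UNIV: "measure (density M h) UNIV = integral\<^sup>L M h"
proof -
  have meas: "apply_bcontfun g \<in> borel_measurable M" for g :: "'a \<Rightarrow>\<^sub>C real"
    unfolding borel_measurable_finite_borel[OF M] by (rule borel_measurable_bcontfun)
  have em: "emeasure (density M h) A = (\<integral>\<^sup>+x. ennreal (h x) * indicator A x \<partial>M)" if "A \<in> sets borel" for A
    using that meas[of h] by (intro emeasure_density) (auto simp: finite_borel_sets[OF M])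
  have le: "emeasure (density M h) A \<le> emeasure M A" if A: "A \<in> sets borel" for A
  proof -
    have "emeasure (density M h) A \<le> (\<integral>\<^sup>+x. indicator A x \<partial>M)"
      unfolding em[OF A] using h(2)
      by (intro nn_integral_mono) (auto simp: indicator_def ennreal_le_1)
    then show ?thesis using A by (simp add: finite_borel_sets[OF M])
  qed
  have fin: "emeasure M A \<noteq> \<infinity>" for A
    using finite_measure.emeasure_finite[OF finite_borel_finite[OF M]] by simp
  show fb: "finite_borel (density M h)"
    unfolding finite_borel_def
  proof (intro conjI finite_measureI)
    show "emeasure (density M h) (space (density M h)) \<noteq> \<infinity>"
      using le[of UNIV] fin[of UNIV] by (auto simp: finite_borel_space[OF M] top_unique)
  qed (simp add: finite_borel_sets[OF M])
  show "measure (density M h) A \<le> measure M A" if "A \<in> sets borel"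
    unfolding measure_def using le[OF that] fin by (intro enn2real_mono) (auto simp: top.not_eq_extremum)
  have "{x. h x = 0} \<in> sets borel"
    using borel_measurable_bcontfun[of h] by measurable
  then have "emeasure (density M h) {x. h x = 0} = (\<integral>\<^sup>+x. 0 \<partial>M)"
    unfolding em[OF \<open>{x. h x = 0} \<in> sets borel\<close>] by (intro nn_integral_cong) (auto simp: indicator_def)
  then show "measure (density M h) {x. h x = 0} = 0" by (simp add: measure_def)
  have int: "integral\<^sup>L (density M h) g = integral\<^sup>L M (\<lambda>x. h x *\<^sub>R g x)"
    if "g \<in> borel_measurable M" for g :: "'a \<Rightarrow> real"
    using that meas h by (intro integral_density) auto
  show "integral\<^sup>L (density M h) g = integral\<^sup>L M (\<lambda>x. h x * g x)" for g :: "'a \<Rightarrow>\<^sub>C real"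
    using int[OF meas] by simp
  show "measure (density M h) UNIV = integral\<^sup>L M h"
    using int[of "\<lambda>_. 1"] by (simp add: finite_borel_space[OF M])
qed

lemma
  assumes M: "finite_borel M" and "0 \<le> c"
  shows finite_borel_scale_measure: "finite_borel (scale_measure (ennreal c) M)"
    and integral_scale_measure_bcontfun:
      "\<And>g :: 'a::topological_space \<Rightarrow>\<^sub>C real. integral\<^sup>L (scale_measure (ennreal c) M) g = c * integral\<^sup>L M g"
proof -
  show "finite_borel (scale_measure (ennreal c) M)"
    unfolding finite_borel_def
  proof (intro conjI finite_measureI)
    have "emeasure M UNIV \<noteq> \<infinity>"
      using finite_measure.emeasure_finite[OF finite_borel_finite[OF M]] by simp
    then show "emeasure (scale_measure (ennreal c) M) (space (scale_measure (ennreal c) M)) \<noteq> \<infinity>"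
      by (simp add: ennreal_mult_eq_top_iff space_scale_measure finite_borel_space[OF M])
  qed (simp add: finite_borel_sets[OF M])
  \<comment> \<open>Viewing scaling as a constant density makes the integral formula for densities
    available.\<close>
  have eq: "scale_measure (ennreal c) M = density M (\<lambda>_. ennreal c)"
    by (rule measure_eqI) (simp_all add: emeasure_density_const)
  show "integral\<^sup>L (scale_measure (ennreal c) M) g = c * integral\<^sup>L M g" for g :: "'a \<Rightarrow>\<^sub>C real"
    unfolding eq using \<open>0 \<le> c\<close> borel_measurable_bcontfun[of g]
    by (subst integral_density) (simp_all add: borel_measurable_finite_borel[OF M])
qed

lemma signed_integral_measure_diff_bcontfun:
  fixes g :: "'a::topological_space \<Rightarrow>\<^sub>C real"
  assumes "finite_borel M" "finite_borel N"
  shows "signed_integral (\<lambda>A. measure M A - measure N A) g = integral\<^sup>L M g - integral\<^sup>L N g"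
  using assms borel_measurable_bcontfun abs_bcontfun_le by (rule signed_integral_measure_diff)

lemma signed_integral_measure:
  fixes g :: "'a::topological_space \<Rightarrow>\<^sub>C real"
  assumes "finite_borel M"
  shows "signed_integral (measure M) g = integral\<^sup>L M g"
proof -
  \<comment> \<open>A nonnegative measure is the difference of itself and the zero measure.\<close>
  have "finite_borel (null_measure borel :: 'a measure)"
    unfolding finite_borel_def by (auto intro: finite_measureI)
  from signed_integral_measure_diff_bcontfun[OF assms this, of g] show ?thesis
    by simp
qed

section \<open>Cutoffs of measures in the ball and of elements of \<open>W\<close>\<close>

lemma measure_ball_regular: "\<mu> \<in> measure_ball \<Longrightarrow> \<mu> \<in> regular_measures"
  unfolding measure_ball_def by simp

lemma measure_ball_tv_norm: "\<mu> \<in> measure_ball \<Longrightarrow> tv_norm \<mu> \<le> 1"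
  unfolding measure_ball_def by simp

lemma measure_ball_uminus: "\<mu> \<in> measure_ball \<Longrightarrow> (\<lambda>A. - \<mu> A) \<in> measure_ball"
  unfolding measure_ball_def tv_norm_def by (simp add: variation_uminus regular_measures_uminus)

lemma pos_part_nonneg:
  assumes "signed_borel_measure \<mu>"
  shows "0 \<le> pos_part \<mu> A"
proof -
  obtain M where "measure M = pos_part \<mu>"
    using Jordan_decomposition[OF assms] by blast
  then show ?thesis using measure_nonneg[of M A] by simp
qed

text \<open>Here \<open>\<eta>\<close> is the measure \<open>h \<mu>\<close>. The last clause
  ensures that a compensation of \<open>\<eta>\<close>, lying below its positive part, puts no mass
  where \<open>h\<close> vanishes.\<close>

lemma measure_ball_times:
  fixes \<mu> :: "'a::t2_space set \<Rightarrow> real" and h :: "'a \<Rightarrow>\<^sub>C real"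
  assumes \<mu>: "\<mu> \<in> measure_ball" and h: "\<And>x. 0 \<le> h x" "\<And>x. h x \<le> 1"
  shows "\<exists>\<eta>\<in>measure_ball. (\<forall>g :: 'a \<Rightarrow>\<^sub>C real. signed_integral \<eta> g = signed_integral \<mu> (\<lambda>x. h x * g x)) \<and>
    \<eta> UNIV = signed_integral \<mu> h \<and> (\<forall>A\<in>sets borel. pos_part \<eta> A \<le> pos_part \<mu> A) \<and>
    pos_part \<eta> {x. h x = 0} \<le> 0"
proof -
  note reg = measure_ball_regular[OF \<mu>]
  obtain M N where fb: "finite_borel M" "finite_borel N"
    and MN: "measure M = pos_part \<mu>" "measure N = neg_part \<mu>"
    and int: "\<And>g. signed_integral \<mu> g = integral\<^sup>L M g - integral\<^sup>L N g"
    using Jordan_decomposition[OF regular_measures_signed[OF reg]] by blast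
  define \<eta> where "\<eta> = (\<lambda>A. measure (density M h) A - measure (density N h) A)"
  note fb' = finite_borel_density[OF fb(1) h] finite_borel_density[OF fb(2) h]
  note le = measure_density_le[OF fb(1) h] measure_density_le[OF fb(2) h]
  have var: "variation \<eta> A \<le> variation \<mu> A" if A: "A \<in> sets borel" for A
    using variation_measure_diff_le[OF fb' A] le[OF A]
    unfolding \<eta>_def variation_def[of \<mu>] MN by linarith
  have "\<eta> \<in> regular_measures"
  \<comment> \<open>The domination criterion takes two measures; \<open>\<mu>\<close> serves as
    both.\<close>
  proof (rule regular_measures_dominated[OF _ reg reg zero_less_one])
    show "signed_borel_measure \<eta>"
      unfolding \<eta>_def using fb' by (rule signed_borel_measure_measure_diff)
    show "variation \<eta> A \<le> 1 * (variation \<mu> A + variation \<mu> A)" if "A \<in> sets borel" for A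
      using var[OF that] order_trans[OF abs_ge_zero abs_le_variation[OF regular_measures_signed[OF reg], of A]]
      by simp
  qed
  moreover have "tv_norm \<eta> \<le> 1"
    using var[of UNIV] measure_ball_tv_norm[OF \<mu>] unfolding tv_norm_def by simp
  ultimately have "\<eta> \<in> measure_ball" unfolding measure_ball_def by simp
  moreover have "signed_integral \<eta> g = signed_integral \<mu> (\<lambda>x. h x * g x)" for g :: "'a \<Rightarrow>\<^sub>C real"
    unfolding \<eta>_def signed_integral_measure_diff_bcontfun[OF fb'] int
    using integral_density_bcontfun[OF fb(1) h] integral_density_bcontfun[OF fb(2) h] by simp
  moreover have "\<eta> UNIV = signed_integral \<mu> h"
    unfolding \<eta>_def int measure_density_UNIV[OF fb(1) h] measure_density_UNIV[OF fb(2) h] ..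
  moreover have "pos_part \<eta> A \<le> pos_part \<mu> A" if A: "A \<in> sets borel" for A
    using pos_part_measure_diff_le[OF fb' A] le(1)[OF A] unfolding \<eta>_def MN by linarith
  moreover have "{x. h x = 0} \<in> sets borel"
    using borel_measurable_bcontfun[of h] by measurable
  then have "pos_part \<eta> {x. h x = 0} \<le> 0"
    using pos_part_measure_diff_le[OF fb', of "{x. h x = 0}"] measure_density_zero[OF fb(1) h]
    unfolding \<eta>_def by simp
  ultimately show ?thesis by blast
qed

lemma W_iff:
  fixes F :: "'a::topological_space \<Rightarrow> 'a set \<Rightarrow> real"
  shows "F \<in> W \<longleftrightarrow> (\<forall>t. F t \<in> measure_ball) \<and>
    (\<forall>g :: 'a \<Rightarrow>\<^sub>C real. continuous_on UNIV (\<lambda>t. signed_integral (F t) g))"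
  using measure_ball_regular
  by (auto simp: W_def continuous_map_in_subtopology continuous_map_weak_star)

lemma apply_Bcontfun:
  fixes k :: "'a::topological_space \<Rightarrow> real"
  assumes "continuous_on UNIV k" "\<And>x. \<bar>k x\<bar> \<le> b"
  shows "apply_bcontfun (Bcontfun k) = k"
  using assms by (intro Bcontfun_inverse bcontfun_normI) auto

text \<open>Multiplication by \<open>h\<close> preserves weak* continuity because it is the adjoint
  of the map that sends \<open>g\<close> to \<open>h * g\<close> on continuous functions.\<close>

lemma W_times:
  fixes F :: "'a::t2_space \<Rightarrow> 'a set \<Rightarrow> real" and h :: "'a \<Rightarrow>\<^sub>C real"
  assumes F: "F \<in> W" and h: "\<And>x. 0 \<le> h x" "\<And>x. h x \<le> 1"
  shows "\<exists>H\<in>W. \<forall>t. H t UNIV = signed_integral (F t) h \<and>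
    (\<forall>A\<in>sets borel. pos_part (H t) A \<le> pos_part (F t) A) \<and> pos_part (H t) {x. h x = 0} \<le> 0"
proof -
  have "\<forall>t. \<exists>\<eta>. \<eta> \<in> measure_ball \<and>
    (\<forall>g :: 'a \<Rightarrow>\<^sub>C real. signed_integral \<eta> g = signed_integral (F t) (\<lambda>x. h x * g x)) \<and>
    \<eta> UNIV = signed_integral (F t) h \<and> (\<forall>A\<in>sets borel. pos_part \<eta> A \<le> pos_part (F t) A) \<and>
    pos_part \<eta> {x. h x = 0} \<le> 0"
    using measure_ball_times[OF _ h] F unfolding W_iff by blast
  from choice[OF this] obtain H where H: "\<And>t. H t \<in> measure_ball"
    "\<And>t (g :: 'a \<Rightarrow>\<^sub>C real). signed_integral (H t) g = signed_integral (F t) (\<lambda>x. h x * g x)"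
    "\<And>t. H t UNIV = signed_integral (F t) h"
    "\<And>t A. A \<in> sets borel \<Longrightarrow> pos_part (H t) A \<le> pos_part (F t) A"
    "\<And>t. pos_part (H t) {x. h x = 0} \<le> 0" by blast
  have "continuous_on UNIV (\<lambda>t. signed_integral (H t) g)" for g :: "'a \<Rightarrow>\<^sub>C real"
  proof -
    have "\<bar>h x * g x\<bar> \<le> norm h * norm g" for x
      unfolding abs_mult by (intro mult_mono abs_bcontfun_le) auto
    then have "apply_bcontfun (Bcontfun (\<lambda>x. h x * g x)) = (\<lambda>x. h x * g x)"
      by (intro apply_Bcontfun continuous_intros) auto
    then show ?thesis using F unfolding W_iff H(2) by metis
  qed
  then have "H \<in> W" using H(1) unfolding W_iff by blast
  then show ?thesis using H(3-5) by blast
qed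

lemma W_uminus: "F \<in> W \<Longrightarrow> (\<lambda>t A. - F t A) \<in> W"
  by (simp add: W_iff measure_ball_uminus signed_integral_uminus continuous_on_minus)

text \<open>\<open>G\<close> compensates \<open>h F\<close>. A compensation keeps a positive total
  mass and is zero otherwise, so its mass is the positive part of the integral of \<open>h\<close>.
  This formula will give the continuity of the normalizing factor.\<close>

lemma ex_cutoff_compensation:
  fixes F :: "'a::t2_space \<Rightarrow> 'a set \<Rightarrow> real" and h :: "'a \<Rightarrow>\<^sub>C real"
  assumes comp: "admits_local_compensation TYPE('a)"
    and F: "F \<in> W" and h: "\<And>x. 0 \<le> h x" "\<And>x. h x \<le> 1"
  shows "\<exists>G\<in>W. \<forall>t. (\<forall>A\<in>sets borel. 0 \<le> G t A \<and> G t A \<le> pos_part (F t) A) \<and>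
    G t UNIV = max 0 (signed_integral (F t) h) \<and> G t {x. h x = 0} = 0"
proof -
  obtain H where H: "H \<in> W" and HU: "\<And>t. H t UNIV = signed_integral (F t) h"
    and Hle: "\<And>t A. A \<in> sets borel \<Longrightarrow> pos_part (H t) A \<le> pos_part (F t) A"
    and H0: "\<And>t. pos_part (H t) {x. h x = 0} \<le> 0"
    using W_times[OF F h] by blast
  obtain G where G: "G \<in> W" "compensation G H"
    using comp H unfolding admits_local_compensation_def by blast
  have Z: "{x. h x = 0} \<in> sets borel"
    using borel_measurable_bcontfun[of h] by measurable
  have *: "measure_compensation (G t) (H t)" for t
    using G(2) unfolding compensation_def by blast
  have "(\<forall>A\<in>sets borel. 0 \<le> G t A \<and> G t A \<le> pos_part (F t) A) \<and>
    G t UNIV = max 0 (signed_integral (F t) h) \<and> G t {x. h x = 0} = 0" for t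
  proof (cases "H t UNIV > 0")
    case True
    then have GH: "\<And>A. A \<in> sets borel \<Longrightarrow> 0 \<le> G t A" "\<And>A. A \<in> sets borel \<Longrightarrow> G t A \<le> pos_part (H t) A"
      "G t UNIV = H t UNIV"
      using *[of t] unfolding measure_compensation_def by auto
    have "G t A \<le> pos_part (F t) A" if "A \<in> sets borel" for A
      using GH(2)[OF that] Hle[OF that, of t] by linarith
    moreover have "G t {x. h x = 0} = 0" using GH(1,2)[OF Z] H0[of t] by linarith
    ultimately show ?thesis using GH(1,3) True HU[of t] by simp
  next
    case False
    then have "G t = (\<lambda>_. 0)" using *[of t] unfolding measure_compensation_def by auto
    moreover have "signed_borel_measure (F t)"
      using F regular_measures_signed measure_ball_regular unfolding W_iff by blast
    ultimately show ?thesis using False HU[of t] by (simp add: pos_part_nonneg)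
  qed
  then show ?thesis using G(1) by blast
qed

section \<open>The normalized compensation\<close>

text \<open>The set where \<open>f\<close> differs from \<open>c\<close> lies in the null set where
  \<open>h\<close> vanishes.\<close>

lemma integral_eq_on_support:
  fixes f h :: "'a::topological_space \<Rightarrow>\<^sub>C real"
  assumes M: "finite_borel M" and 0: "measure M {x. h x = 0} = 0" and f: "\<And>x. h x \<noteq> 0 \<Longrightarrow> f x = c"
  shows "integral\<^sup>L M f = c * measure M UNIV"
proof -
  have Z: "{x. h x = 0} \<in> sets M"
    unfolding finite_borel_sets[OF M] using borel_measurable_bcontfun[of h] by measurable
  have "emeasure M {x. h x = 0} = 0"
    using 0 finite_measure.emeasure_eq_measure[OF finite_borel_finite[OF M]] by simp
  then have "AE x in M. f x = c"
    using f Z by (intro AE_I'[of "{x. h x = 0}"]) auto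
  then have "integral\<^sup>L M f = integral\<^sup>L M (\<lambda>_. c)"
    using borel_measurable_bcontfun[of f]
    by (intro integral_cong_AE) (auto simp: borel_measurable_finite_borel[OF M])
  then show ?thesis by (simp add: finite_borel_space[OF M])
qed

lemma measure_split_UNIV:
  assumes "finite_borel M" "B \<in> sets borel"
  shows "measure M UNIV = measure M B + measure M (- B)"
  using assms finite_measure.finite_measure_Union[OF finite_borel_finite, of M B "- B"]
  by (simp add: finite_borel_sets)

lemma ex_finite_borel:
  assumes "signed_borel_measure \<nu>" "\<And>A. A \<in> sets borel \<Longrightarrow> 0 \<le> \<nu> A"
  shows "\<exists>M. finite_borel M \<and> measure M = \<nu>"
  using finite_measure_borel_measure_of[OF assms] measure_borel_measure_of[OF assms]
  by (intro exI[of _ "borel_measure_of \<nu>"]) (simp add: finite_borel_def)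

text \<open>\<open>\<nu>\<^sub>1\<close> lives where \<open>f\<^sub>0\<close> is 1 and
  \<open>\<nu>\<^sub>2\<close> where it is -1, so their difference integrates
  \<open>f\<^sub>0\<close> to the sum \<open>s\<close> of their masses. This \<open>s\<close> also
  bounds the norm of the difference, and division by \<open>s\<close> gives both properties.\<close>

lemma normalized_difference_in_pi2:
  fixes f\<^sub>0 h\<^sub>1 h\<^sub>2 :: "'a::t2_space \<Rightarrow>\<^sub>C real"
  assumes reg: "\<nu>\<^sub>1 \<in> regular_measures" "\<nu>\<^sub>2 \<in> regular_measures"
    and nonneg: "\<And>A. A \<in> sets borel \<Longrightarrow> 0 \<le> \<nu>\<^sub>1 A" "\<And>A. A \<in> sets borel \<Longrightarrow> 0 \<le> \<nu>\<^sub>2 A"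
    and zero: "\<nu>\<^sub>1 {x. h\<^sub>1 x = 0} = 0" "\<nu>\<^sub>2 {x. h\<^sub>2 x = 0} = 0"
    and f\<^sub>0: "\<And>x. h\<^sub>1 x \<noteq> 0 \<Longrightarrow> f\<^sub>0 x = 1" "\<And>x. h\<^sub>2 x \<noteq> 0 \<Longrightarrow> f\<^sub>0 x = - 1"
    and s: "s = \<nu>\<^sub>1 UNIV + \<nu>\<^sub>2 UNIV" "s > 0"
  shows "(\<lambda>A. (\<nu>\<^sub>1 A - \<nu>\<^sub>2 A) / s) \<in> pi2 f\<^sub>0"
    and "\<And>g :: 'a \<Rightarrow>\<^sub>C real. signed_integral (\<lambda>A. (\<nu>\<^sub>1 A - \<nu>\<^sub>2 A) / s) g =
      (signed_integral \<nu>\<^sub>1 g - signed_integral \<nu>\<^sub>2 g) / s"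
proof -
  obtain M where M: "finite_borel M" "measure M = \<nu>\<^sub>1"
    using ex_finite_borel[OF regular_measures_signed[OF reg(1)] nonneg(1)] by blast
  obtain N where N: "finite_borel N" "measure N = \<nu>\<^sub>2"
    using ex_finite_borel[OF regular_measures_signed[OF reg(2)] nonneg(2)] by blast
  have s': "0 \<le> 1 / s" using s by simp
  let ?M = "scale_measure (ennreal (1 / s)) M" and ?N = "scale_measure (ennreal (1 / s)) N"
  let ?P = "\<lambda>A. (\<nu>\<^sub>1 A - \<nu>\<^sub>2 A) / s"
  have sc: "measure ?M A = \<nu>\<^sub>1 A / s" "measure ?N A = \<nu>\<^sub>2 A / s" for A
    using s' M(2) N(2) by simp_all
  have P: "?P = (\<lambda>A. measure ?M A - measure ?N A)"
    unfolding sc by (simp add: diff_divide_distrib)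
  note fb = finite_borel_scale_measure[OF M(1) s'] finite_borel_scale_measure[OF N(1) s']
  have int: "signed_integral ?P g = (integral\<^sup>L M g - integral\<^sup>L N g) / s" for g :: "'a \<Rightarrow>\<^sub>C real"
    unfolding P signed_integral_measure_diff_bcontfun[OF fb]
      integral_scale_measure_bcontfun[OF M(1) s'] integral_scale_measure_bcontfun[OF N(1) s']
    by (simp add: diff_divide_distrib)
  show "signed_integral ?P g = (signed_integral \<nu>\<^sub>1 g - signed_integral \<nu>\<^sub>2 g) / s" for g :: "'a \<Rightarrow>\<^sub>C real"
    unfolding int using signed_integral_measure[OF M(1), of g] signed_integral_measure[OF N(1), of g]
    by (simp add: M(2) N(2))
  have var: "variation ?P A \<le> (\<nu>\<^sub>1 A + \<nu>\<^sub>2 A) / s" if "A \<in> sets borel" for A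
    using variation_measure_diff_le[OF fb that] unfolding sc by (simp add: add_divide_distrib diff_divide_distrib)
  have "?P \<in> regular_measures"
  proof (rule regular_measures_dominated[OF _ reg])
    show "signed_borel_measure ?P"
      unfolding P using fb by (rule signed_borel_measure_measure_diff)
    show "0 < 1 / s" using s by simp
    show "variation ?P A \<le> 1 / s * (variation \<nu>\<^sub>1 A + variation \<nu>\<^sub>2 A)" if A: "A \<in> sets borel" for A
    proof -
      have "\<nu>\<^sub>1 A + \<nu>\<^sub>2 A \<le> variation \<nu>\<^sub>1 A + variation \<nu>\<^sub>2 A"
        using abs_le_variation[OF regular_measures_signed[OF reg(1)], of A]
          abs_le_variation[OF regular_measures_signed[OF reg(2)], of A] by linarith
      then have "(\<nu>\<^sub>1 A + \<nu>\<^sub>2 A) / s \<le> (variation \<nu>\<^sub>1 A + variation \<nu>\<^sub>2 A) / s"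
        using s by (intro divide_right_mono) auto
      then show ?thesis using var[OF A] by simp
    qed
  qed
  moreover have "tv_norm ?P \<le> 1"
    using var[of UNIV] s unfolding tv_norm_def by simp
  moreover have "signed_integral ?P f\<^sub>0 = 1"
  proof -
    have "integral\<^sup>L M f\<^sub>0 = 1 * measure M UNIV"
      using M zero(1) f\<^sub>0(1) by (intro integral_eq_on_support[of M h\<^sub>1]) auto
    moreover have "integral\<^sup>L N f\<^sub>0 = - 1 * measure N UNIV"
      using N zero(2) f\<^sub>0(2) by (intro integral_eq_on_support[of N h\<^sub>2]) auto
    ultimately show ?thesis unfolding int using s M N by simp
  qed
  ultimately show "?P \<in> pi2 f\<^sub>0" unfolding pi2_def measure_ball_def by simp
qed

text \<open>Dividing by \<open>s\<close> instead of 1 costs at most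
  \<open>(1 / s - 1) * s = 1 - s\<close>. The parts of \<mu> left out by
  \<open>\<nu>\<^sub>1\<close> and \<open>\<nu>\<^sub>2\<close> have total mass
  \<open>tv_norm \<mu> - s\<close>, again at most \<open>1 - s\<close>.\<close>

lemma tv_norm_normalized_difference_le:
  fixes \<mu> :: "'a::topological_space set \<Rightarrow> real"
  assumes \<mu>: "signed_borel_measure \<mu>" "tv_norm \<mu> \<le> 1"
    and signed: "signed_borel_measure \<nu>\<^sub>1" "signed_borel_measure \<nu>\<^sub>2"
    and nonneg: "\<And>A. A \<in> sets borel \<Longrightarrow> 0 \<le> \<nu>\<^sub>1 A" "\<And>A. A \<in> sets borel \<Longrightarrow> 0 \<le> \<nu>\<^sub>2 A"
    and le: "\<And>A. A \<in> sets borel \<Longrightarrow> \<nu>\<^sub>1 A \<le> pos_part \<mu> A" "\<And>A. A \<in> sets borel \<Longrightarrow> \<nu>\<^sub>2 A \<le> neg_part \<mu> A"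
    and s: "s = \<nu>\<^sub>1 UNIV + \<nu>\<^sub>2 UNIV" "s > 0"
  shows "tv_norm (\<lambda>A. (\<nu>\<^sub>1 A - \<nu>\<^sub>2 A) / s - \<mu> A) \<le> 2 * (1 - s)"
proof -
  obtain M\<^sub>1 where M\<^sub>1: "finite_borel M\<^sub>1" "measure M\<^sub>1 = \<nu>\<^sub>1"
    using ex_finite_borel[OF signed(1) nonneg(1)] by blast
  obtain M\<^sub>2 where M\<^sub>2: "finite_borel M\<^sub>2" "measure M\<^sub>2 = \<nu>\<^sub>2"
    using ex_finite_borel[OF signed(2) nonneg(2)] by blast
  obtain M N where MN: "finite_borel M" "finite_borel N" "measure M = pos_part \<mu>" "measure N = neg_part \<mu>"
    and \<mu>_eq: "\<mu> = (\<lambda>A. measure M A - measure N A)"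
    using Jordan_decomposition[OF \<mu>(1)] by blast
  define p n where "p = measure M" and "n = measure N"
  have total: "p UNIV + n UNIV \<le> 1"
    using \<mu>(2) unfolding tv_norm_def variation_def p_def n_def MN .
  note le = le[folded MN(3,4) p_def n_def]
  have \<mu>B: "\<mu> B = p B - n B" for B unfolding \<mu>_eq p_def n_def ..
  have s1: "s \<le> 1" using le(1)[of UNIV] le(2)[of UNIV] total s by simp
  define c where "c = 1 / s - 1"
  have c: "0 \<le> c" "c * s = 1 - s"
    using s(2) s1 unfolding c_def by (simp_all add: field_simps)
  \<comment> \<open>All four set functions are additive and nonnegative on the complement of
    \<open>B\<close>.\<close>
  have mono: "\<nu>\<^sub>1 B \<le> \<nu>\<^sub>1 UNIV" "\<nu>\<^sub>2 B \<le> \<nu>\<^sub>2 UNIV" "p B - \<nu>\<^sub>1 B \<le> p UNIV - \<nu>\<^sub>1 UNIV" "n B - \<nu>\<^sub>2 B \<le> n UNIV - \<nu>\<^sub>2 UNIV"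
    if B: "B \<in> sets borel" for B
  proof -
    have B': "- B \<in> sets borel" using B by auto
    note sp = measure_split_UNIV[OF M\<^sub>1(1) B, unfolded M\<^sub>1(2)] measure_split_UNIV[OF M\<^sub>2(1) B, unfolded M\<^sub>2(2)]
      measure_split_UNIV[OF MN(1) B, folded p_def] measure_split_UNIV[OF MN(2) B, folded n_def]
    show "\<nu>\<^sub>1 B \<le> \<nu>\<^sub>1 UNIV" "\<nu>\<^sub>2 B \<le> \<nu>\<^sub>2 UNIV" "p B - \<nu>\<^sub>1 B \<le> p UNIV - \<nu>\<^sub>1 UNIV" "n B - \<nu>\<^sub>2 B \<le> n UNIV - \<nu>\<^sub>2 UNIV"
      using sp nonneg[OF B'] le[OF B'] by linarith+
  qed
  have eq: "(\<nu>\<^sub>1 B - \<nu>\<^sub>2 B) / s - \<mu> B = c * \<nu>\<^sub>1 B - c * \<nu>\<^sub>2 B - (p B - \<nu>\<^sub>1 B) + (n B - \<nu>\<^sub>2 B)" for B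
    unfolding c_def \<mu>B by (simp add: algebra_simps diff_divide_distrib)
  \<comment> \<open>Of the four nonnegative terms in \<open>eq\<close>, the two with a plus sign
    bound the value from above and the two with a minus sign bound its negative.\<close>
  have "tv_norm (\<lambda>A. (\<nu>\<^sub>1 A - \<nu>\<^sub>2 A) / s - \<mu> A) \<le>
      (c * \<nu>\<^sub>1 UNIV + (n UNIV - \<nu>\<^sub>2 UNIV)) + (c * \<nu>\<^sub>2 UNIV + (p UNIV - \<nu>\<^sub>1 UNIV))"
    unfolding tv_norm_def
  proof (rule variation_le)
    fix B :: "'a set" assume B: "B \<in> sets borel"
    have "0 \<le> c * \<nu>\<^sub>1 B" "0 \<le> c * \<nu>\<^sub>2 B" "c * \<nu>\<^sub>1 B \<le> c * \<nu>\<^sub>1 UNIV" "c * \<nu>\<^sub>2 B \<le> c * \<nu>\<^sub>2 UNIV"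
      using c(1) nonneg[OF B] mono[OF B] by (auto intro: mult_left_mono)
    then show "(\<nu>\<^sub>1 B - \<nu>\<^sub>2 B) / s - \<mu> B \<le> c * \<nu>\<^sub>1 UNIV + (n UNIV - \<nu>\<^sub>2 UNIV)"
      "- ((\<nu>\<^sub>1 B - \<nu>\<^sub>2 B) / s - \<mu> B) \<le> c * \<nu>\<^sub>2 UNIV + (p UNIV - \<nu>\<^sub>1 UNIV)"
      unfolding eq using mono(3,4)[OF B] le[OF B] by linarith+
  qed simp
  also have "\<dots> = c * s + (p UNIV + n UNIV) - s"
    unfolding s(1) by (simp add: algebra_simps)
  finally show ?thesis using c(2) total by simp
qed

text \<open>\<open>G\<^sub>1\<close> and \<open>G\<^sub>2\<close> are taken below the positive and
  the negative part of \<open>F\<close>. Their masses are positive parts of integrals, hence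
  \<open>s\<close> is continuous and at least the difference in the hypothesis on \<open>r\<close>,
  which keeps it away from 0 on \<open>V\<close>.\<close>

lemma ex_continuous_approximation:
  fixes f\<^sub>0 h\<^sub>1 h\<^sub>2 :: "'a::t2_space \<Rightarrow>\<^sub>C real" and V :: "'a set"
  assumes comp: "admits_local_compensation TYPE('a)" and F: "F \<in> W"
    and h\<^sub>1: "\<And>x. 0 \<le> h\<^sub>1 x" "\<And>x. h\<^sub>1 x \<le> 1" "\<And>x. h\<^sub>1 x \<noteq> 0 \<Longrightarrow> f\<^sub>0 x = 1"
    and h\<^sub>2: "\<And>x. 0 \<le> h\<^sub>2 x" "\<And>x. h\<^sub>2 x \<le> 1" "\<And>x. h\<^sub>2 x \<noteq> 0 \<Longrightarrow> f\<^sub>0 x = - 1"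
    and r: "r < 1" "\<And>t. t \<in> V \<Longrightarrow> 1 - r \<le> signed_integral (F t) h\<^sub>1 - signed_integral (F t) h\<^sub>2"
  shows "\<exists>P. continuous_map (top_of_set V) (subtopology weak_star (pi2 f\<^sub>0)) P \<and>
    (\<forall>t\<in>V. tv_norm (\<lambda>A. P t A - F t A) \<le> 2 * r)"
proof -
  obtain G\<^sub>1 where G\<^sub>1: "G\<^sub>1 \<in> W" "\<And>t A. A \<in> sets borel \<Longrightarrow> 0 \<le> G\<^sub>1 t A"
    "\<And>t A. A \<in> sets borel \<Longrightarrow> G\<^sub>1 t A \<le> pos_part (F t) A"
    "\<And>t. G\<^sub>1 t UNIV = max 0 (signed_integral (F t) h\<^sub>1)" "\<And>t. G\<^sub>1 t {x. h\<^sub>1 x = 0} = 0"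
    using ex_cutoff_compensation[OF comp F h\<^sub>1(1,2)] by blast
  obtain G\<^sub>2 where G\<^sub>2: "G\<^sub>2 \<in> W" "\<And>t A. A \<in> sets borel \<Longrightarrow> 0 \<le> G\<^sub>2 t A"
    "\<And>t A. A \<in> sets borel \<Longrightarrow> G\<^sub>2 t A \<le> pos_part (\<lambda>A. - F t A) A"
    "\<And>t. G\<^sub>2 t UNIV = max 0 (signed_integral (\<lambda>A. - F t A) h\<^sub>2)" "\<And>t. G\<^sub>2 t {x. h\<^sub>2 x = 0} = 0"
    using ex_cutoff_compensation[OF comp W_uminus[OF F] h\<^sub>2(1,2)] by blast
  note reg = measure_ball_regular[OF W_iff[THEN iffD1, THEN conjunct1, rule_format]]
  note signed = regular_measures_signed[OF reg]
  define s where "s = (\<lambda>t. G\<^sub>1 t UNIV + G\<^sub>2 t UNIV)"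
  \<comment> \<open>\<open>P\<close> is total: where \<open>s t = 0\<close>, division gives the zero
    measure, but such \<open>t\<close> lie outside \<open>V\<close>.\<close>
  define P where "P = (\<lambda>t A. (G\<^sub>1 t A - G\<^sub>2 t A) / s t)"
  have s_ge: "1 - r \<le> s t" if "t \<in> V" for t
    using r(2)[OF that] unfolding s_def G\<^sub>1(4) G\<^sub>2(4) signed_integral_uminus by linarith
  have s_pos: "0 < s t" if "t \<in> V" for t
    using s_ge[OF that] r(1) by linarith
  have P: "P t \<in> pi2 f\<^sub>0"
    "\<And>g :: 'a \<Rightarrow>\<^sub>C real. signed_integral (P t) g = (signed_integral (G\<^sub>1 t) g - signed_integral (G\<^sub>2 t) g) / s t"
    if "t \<in> V" for t
    unfolding P_def
    using normalized_difference_in_pi2[OF reg[OF G\<^sub>1(1)] reg[OF G\<^sub>2(1)] G\<^sub>1(2) G\<^sub>2(2) G\<^sub>1(5) G\<^sub>2(5) h\<^sub>1(3) h\<^sub>2(3)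
        fun_cong[OF s_def] s_pos[OF that]] by blast+
  have cont: "continuous_on V (\<lambda>t. signed_integral (H t) g)" if "H \<in> W" for H and g :: "'a \<Rightarrow>\<^sub>C real"
    using that continuous_on_subset unfolding W_iff by blast
  have "continuous_on V s"
    unfolding s_def G\<^sub>1(4) G\<^sub>2(4) by (intro continuous_intros cont F W_uminus[OF F])
  then have "continuous_on V (\<lambda>t. (signed_integral (G\<^sub>1 t) g - signed_integral (G\<^sub>2 t) g) / s t)" for g :: "'a \<Rightarrow>\<^sub>C real"
    using s_pos by (intro continuous_on_divide continuous_on_diff cont G\<^sub>1(1) G\<^sub>2(1)) force+
  then have "continuous_on V (\<lambda>t. signed_integral (P t) g)" for g :: "'a \<Rightarrow>\<^sub>C real"
    using P(2) by (simp cong: continuous_on_cong)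
  moreover have "P \<in> V \<rightarrow> pi2 f\<^sub>0" using P(1) by blast
  moreover from this have "P \<in> V \<rightarrow> regular_measures"
    unfolding pi2_def measure_ball_def by blast
  ultimately have "continuous_map (top_of_set V) (subtopology weak_star (pi2 f\<^sub>0)) P"
    by (auto simp: continuous_map_in_subtopology continuous_map_weak_star)
  moreover have "tv_norm (\<lambda>A. P t A - F t A) \<le> 2 * r" if "t \<in> V" for t
  proof -
    have "tv_norm (F t) \<le> 1" using F measure_ball_tv_norm unfolding W_iff by blast
    from tv_norm_normalized_difference_le[OF signed[OF F] this signed[OF G\<^sub>1(1)] signed[OF G\<^sub>2(1)] G\<^sub>1(2) G\<^sub>2(2)
        G\<^sub>1(3) G\<^sub>2(3)[folded neg_part_def] fun_cong[OF s_def] s_pos[OF that]]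
    have "tv_norm (\<lambda>A. P t A - F t A) \<le> 2 * (1 - s t)" unfolding P_def .
    also have "\<dots> \<le> 2 * r" using s_ge[OF that] by simp
    finally show ?thesis .
  qed
  ultimately show ?thesis by blast
qed

section \<open>Almost norming measures\<close>

text \<open>Integrate the first inequality against the positive part and the second against the
  negative part, then add. This transfers almost norming from \<open>f\<close> to \<open>k\<close>:
  with \<open>c = 2 / \<epsilon>\<close> for the truncation and \<open>c = 1 / \<epsilon>\<close>
  for the difference of cutoffs.\<close>

lemma signed_integral_ge:
  fixes f k :: "'a::topological_space \<Rightarrow>\<^sub>C real"
  assumes \<mu>: "signed_borel_measure \<mu>"
    and le: "\<And>x. 1 - k x \<le> c * (1 - f x)" "\<And>x. 1 + k x \<le> c * (1 + f x)"
  shows "tv_norm \<mu> - c * (tv_norm \<mu> - signed_integral \<mu> f) \<le> signed_integral \<mu> k"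
proof -
  obtain M N where fb: "finite_borel M" "finite_borel N"
    and MN: "measure M = pos_part \<mu>" "measure N = neg_part \<mu>"
    and int: "\<And>g. signed_integral \<mu> g = integral\<^sup>L M g - integral\<^sup>L N g"
    using Jordan_decomposition[OF \<mu>] by blast
  have const: "integrable L (\<lambda>_. b)" if "finite_borel L" for L :: "'a measure" and b :: real
    using finite_borel_integrable[OF that, of "\<lambda>_. b" "\<bar>b\<bar>"] by simp
  have M: "measure M UNIV - integral\<^sup>L M k \<le> c * (measure M UNIV - integral\<^sup>L M f)"
  proof -
    have "integral\<^sup>L M (\<lambda>x. 1 - k x) \<le> integral\<^sup>L M (\<lambda>x. c * (1 - f x))"
      using le(1) by (intro integral_mono integrable_mult_right Bochner_Integration.integrable_diff const integrable_bcontfun fb)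
    then show ?thesis
      by (simp add: integrable_bcontfun[OF fb(1)] const[OF fb(1)] finite_borel_space[OF fb(1)])
  qed
  have N: "measure N UNIV + integral\<^sup>L N k \<le> c * (measure N UNIV + integral\<^sup>L N f)"
  proof -
    have "integral\<^sup>L N (\<lambda>x. 1 + k x) \<le> integral\<^sup>L N (\<lambda>x. c * (1 + f x))"
      using le(2) by (intro integral_mono integrable_mult_right Bochner_Integration.integrable_add const integrable_bcontfun fb)
    then show ?thesis
      by (simp add: integrable_bcontfun[OF fb(2)] const[OF fb(2)] finite_borel_space[OF fb(2)])
  qed
  have tv: "tv_norm \<mu> = measure M UNIV + measure N UNIV"
    unfolding tv_norm_def variation_def MN ..
  from M N show ?thesis unfolding tv int by (simp add: algebra_simps)
qed

lemma signed_integral_le_tv_norm: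
  fixes k :: "'a::topological_space \<Rightarrow>\<^sub>C real"
  assumes \<mu>: "signed_borel_measure \<mu>" and k: "norm k \<le> 1"
  shows "signed_integral \<mu> k \<le> tv_norm \<mu>"
proof -
  \<comment> \<open>With \<open>f = k\<close> and \<open>c = 2\<close> the estimate reads
    \<open>T - 2 * (T - y) \<le> y\<close>, that is \<open>y \<le> T\<close>, where \<open>T\<close>
    is the norm and \<open>y\<close> the integral.\<close>
  have "1 - k x \<le> 2 * (1 - k x)" "1 + k x \<le> 2 * (1 + k x)" for x
    using order_trans[OF abs_bcontfun_le[of k x] k] by (auto simp: abs_le_iff)
  from signed_integral_ge[OF \<mu> this] show ?thesis by simp
qed

lemma signed_integral_diff_bcontfun:
  fixes g h :: "'a::topological_space \<Rightarrow>\<^sub>C real"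
  assumes "signed_borel_measure \<mu>"
  shows "signed_integral \<mu> (g - h) = signed_integral \<mu> g - signed_integral \<mu> h"
proof -
  obtain M N where fb: "finite_borel M" "finite_borel N"
    and int: "\<And>g. signed_integral \<mu> g = integral\<^sup>L M g - integral\<^sup>L N g"
    using Jordan_decomposition[OF assms] by blast
  have "apply_bcontfun (g - h) = (\<lambda>x. g x - h x)" by (rule ext) simp
  then show ?thesis
    unfolding int by (simp add: integrable_bcontfun[OF fb(1)] integrable_bcontfun[OF fb(2)])
qed

section \<open>The truncation of \<open>f\<close> and the choice of constants\<close>

theorem lemma2p9:
  fixes f :: "'a::t2_space \<Rightarrow>\<^sub>C real" and \<epsilon> :: real
  assumes "compact (UNIV :: 'a set)"
    and "admits_local_compensation TYPE('a)"
    and "norm f \<le> 1" and "f \<noteq> 0"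
    and "1 - norm f < \<epsilon>" and "\<epsilon> < 1"
  shows "\<exists>f\<^sub>0 :: 'a \<Rightarrow>\<^sub>C real. norm f\<^sub>0 = 1 \<and>
    pi2 f \<subseteq> pi2 f\<^sub>0 \<and> norm (f - f\<^sub>0) \<le> \<epsilon> \<and>
    (\<forall>F\<in>W. \<exists>P :: 'a \<Rightarrow> 'a set \<Rightarrow> real.
       continuous_map (top_of_set (F -` pi2_approx f (\<epsilon>\<^sup>2 / 6)))
         (subtopology weak_star (pi2 f\<^sub>0)) P \<and>
       (\<forall>t \<in> F -` pi2_approx f (\<epsilon>\<^sup>2 / 6). tv_norm (\<lambda>A. P t A - F t A) \<le> \<epsilon>))"
proof -
  have \<epsilon>: "0 < \<epsilon>" "\<epsilon> < 1" using assms(3,5,6) by linarith+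
  have f: "- 1 \<le> f x" "f x \<le> 1" for x
    using abs_bcontfun_le[of f x] assms(3) by linarith+
  define f\<^sub>0 :: "'a \<Rightarrow>\<^sub>C real" where "f\<^sub>0 = Bcontfun (\<lambda>x. max (- 1) (min 1 (f x / (1 - \<epsilon>))))"
  \<comment> \<open>One family for both signs: \<open>h 1\<close> and \<open>h (- 1)\<close> are the
    cutoffs \<open>h\<^sub>1\<close> and \<open>h\<^sub>2\<close>.\<close>
  define h :: "real \<Rightarrow> 'a \<Rightarrow>\<^sub>C real" where "h = (\<lambda>\<sigma>. Bcontfun (\<lambda>x. max 0 ((\<sigma> * f x - (1 - \<epsilon>)) / \<epsilon>)))"
  have f\<^sub>0: "f\<^sub>0 x = max (- 1) (min 1 (f x / (1 - \<epsilon>)))" for x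
    unfolding f\<^sub>0_def using \<epsilon> by (subst apply_Bcontfun[where b=1]) (auto intro!: continuous_intros)
  have h: "h \<sigma> x = max 0 ((\<sigma> * f x - (1 - \<epsilon>)) / \<epsilon>)" if "\<sigma> = 1 \<or> \<sigma> = - 1" for \<sigma> x
  proof -
    have "\<bar>max 0 ((\<sigma> * f x - (1 - \<epsilon>)) / \<epsilon>)\<bar> \<le> 1" for x
      using \<epsilon> f[of x] that by (auto simp: field_simps max_def)
    then show ?thesis
      unfolding h_def using \<epsilon> by (subst apply_Bcontfun[where b=1]) (auto intro!: continuous_intros)
  qed
  have h_bounds: "0 \<le> h \<sigma> x" "h \<sigma> x \<le> 1" if "\<sigma> = 1 \<or> \<sigma> = - 1" for \<sigma> x
    unfolding h[OF that] using \<epsilon> f[of x] that by (auto simp: field_simps max_def)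
  have f\<^sub>0_eq: "f x \<ge> 1 - \<epsilon> \<Longrightarrow> f\<^sub>0 x = 1" "f x \<le> - (1 - \<epsilon>) \<Longrightarrow> f\<^sub>0 x = - 1" for x
    unfolding f\<^sub>0 using \<epsilon> by (auto simp: field_simps max_def min_def)
  \<comment> \<open>A nonzero cutoff means \<open>\<sigma> * f x > 1 - \<epsilon>\<close>, where the
    truncation has already reached \<open>\<sigma>\<close>.\<close>
  have h_support: "f\<^sub>0 x = \<sigma>" if "\<sigma> = 1 \<or> \<sigma> = - 1" "h \<sigma> x \<noteq> 0" for \<sigma> x
    using that(1) that(2)[unfolded h[OF that(1)]] f\<^sub>0_eq[of x] \<epsilon>
    by (auto simp: max_def field_simps split: if_splits)
  have f\<^sub>0_le: "\<bar>f\<^sub>0 x\<bar> \<le> 1" for x unfolding f\<^sub>0 by auto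
  have norm_f\<^sub>0: "norm f\<^sub>0 = 1"
  proof (rule antisym)
    show "norm f\<^sub>0 \<le> 1" using f\<^sub>0_le by (intro norm_bound) simp
    have "\<exists>x. 1 - \<epsilon> < \<bar>f x\<bar>"
    proof (rule ccontr)
      assume "\<not> ?thesis"
      then have "norm f \<le> 1 - \<epsilon>" by (intro norm_bound) (auto simp: not_less)
      then show False using assms(5) by linarith
    qed
    then obtain x where "1 - \<epsilon> < \<bar>f x\<bar>" ..
    then have "f\<^sub>0 x = 1 \<or> f\<^sub>0 x = - 1" using f\<^sub>0_eq[of x] by linarith
    then show "1 \<le> norm f\<^sub>0" using abs_bcontfun_le[of f\<^sub>0 x] by auto
  qed
  have "\<bar>f x - f\<^sub>0 x\<bar> \<le> \<epsilon>" for x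
  proof -
    \<comment> \<open>In the first two cases both functions lie in the same interval of length
      \<epsilon>; in the third the rescaling moves the value by \<epsilon> times a number of modulus
      below 1.\<close>
    consider "f x \<ge> 1 - \<epsilon>" | "f x \<le> - (1 - \<epsilon>)" | "\<bar>f x\<bar> < 1 - \<epsilon>" by linarith
    then show ?thesis
    proof cases
      case 3
      then have "f\<^sub>0 x = f x / (1 - \<epsilon>)"
        unfolding f\<^sub>0 using \<epsilon> by (auto simp: field_simps max_def min_def)
      then have "f x - f\<^sub>0 x = - \<epsilon> * (f x / (1 - \<epsilon>))" using \<epsilon> by (simp add: field_simps)
      then have "\<bar>f x - f\<^sub>0 x\<bar> = \<epsilon> * \<bar>f x / (1 - \<epsilon>)\<bar>" using \<epsilon> by (simp add: abs_mult)
      also have "\<dots> \<le> \<epsilon> * 1" using 3 \<epsilon> by (intro mult_left_mono) auto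
      finally show ?thesis by simp
    qed (use f[of x] f\<^sub>0_eq[of x] in linarith)+
  qed
  then have norm_diff: "norm (f - f\<^sub>0) \<le> \<epsilon>" by (intro norm_bound) simp
  have pi2_sub: "pi2 f \<subseteq> pi2 f\<^sub>0"
  proof
    fix \<mu> assume "\<mu> \<in> pi2 f"
    then have ball: "\<mu> \<in> measure_ball" and one: "signed_integral \<mu> f = 1" unfolding pi2_def by auto
    note signed = regular_measures_signed[OF measure_ball_regular[OF ball]]
    have tv: "tv_norm \<mu> = 1"
      using signed_integral_le_tv_norm[OF signed assms(3)] measure_ball_tv_norm[OF ball] one by linarith
    \<comment> \<open>Either the left side is 0, or the bracket on the right exceeds \<epsilon> and
      the right side exceeds 2, the largest possible left side. As \<open>tv_norm \<mu>\<close>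
      equals the integral of \<open>f\<close>, the error term vanishes whatever the factor.\<close>
    have "1 - f\<^sub>0 x \<le> 2 / \<epsilon> * (1 - f x)" "1 + f\<^sub>0 x \<le> 2 / \<epsilon> * (1 + f x)" for x
    proof -
      show "1 - f\<^sub>0 x \<le> 2 / \<epsilon> * (1 - f x)"
      proof (cases "f x \<ge> 1 - \<epsilon>")
        case True
        then show ?thesis using f\<^sub>0_eq(1)[of x] f[of x] \<epsilon> by simp
      next
        case False
        then have "2 \<le> 2 / \<epsilon> * (1 - f x)" using \<epsilon> by (simp add: field_simps)
        then show ?thesis using f\<^sub>0_le[of x] by linarith
      qed
      show "1 + f\<^sub>0 x \<le> 2 / \<epsilon> * (1 + f x)"
      proof (cases "f x \<le> - (1 - \<epsilon>)")
        case True
        then show ?thesis using f\<^sub>0_eq(2)[of x] f[of x] \<epsilon> by simp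
      next
        case False
        then have "2 \<le> 2 / \<epsilon> * (1 + f x)" using \<epsilon> by (simp add: field_simps)
        then show ?thesis using f\<^sub>0_le[of x] by linarith
      qed
    qed
    from signed_integral_ge[OF signed this] have "1 \<le> signed_integral \<mu> f\<^sub>0"
      unfolding tv one by simp
    moreover have "signed_integral \<mu> f\<^sub>0 \<le> 1"
      using signed_integral_le_tv_norm[OF signed, of f\<^sub>0] norm_f\<^sub>0 tv by simp
    ultimately show "\<mu> \<in> pi2 f\<^sub>0" using ball unfolding pi2_def by simp
  qed
  \<comment> \<open>Here \<open>r = \<epsilon> / 6\<close>: the factor \<open>1 / \<epsilon>\<close>
    turns the defect \<open>\<epsilon>\<^sup>2 / 6\<close> into
    \<open>\<epsilon> / 6\<close>.\<close>
  have "\<exists>P. continuous_map (top_of_set (F -` pi2_approx f (\<epsilon>\<^sup>2 / 6))) (subtopology weak_star (pi2 f\<^sub>0)) P \<and>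
       (\<forall>t \<in> F -` pi2_approx f (\<epsilon>\<^sup>2 / 6). tv_norm (\<lambda>A. P t A - F t A) \<le> 2 * (\<epsilon> / 6))"
    if F: "F \<in> W" for F
  proof (rule ex_continuous_approximation[OF assms(2) F, of "h 1" f\<^sub>0 "h (- 1)"])
    fix t assume "t \<in> F -` pi2_approx f (\<epsilon>\<^sup>2 / 6)"
    then have ball: "F t \<in> measure_ball" and ge: "1 - \<epsilon>\<^sup>2 / 6 \<le> signed_integral (F t) f"
      unfolding pi2_approx_def by auto
    note signed = regular_measures_signed[OF measure_ball_regular[OF ball]]
    \<comment> \<open>The first is an equality where \<open>h 1 x > 0\<close> and says
      \<open>\<epsilon> \<le> 1 - f x\<close> where both cutoffs vanish; where
      \<open>h (- 1) x > 0\<close> it amounts to \<open>\<epsilon> \<le> 1\<close>. The second is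
      symmetric.\<close>
    have "1 - (h 1 - h (- 1)) x \<le> 1 / \<epsilon> * (1 - f x)" "1 + (h 1 - h (- 1)) x \<le> 1 / \<epsilon> * (1 + f x)" for x
      using \<epsilon> f[of x] by (auto simp: h max_def field_simps)
    from signed_integral_ge[OF signed this]
    have "tv_norm (F t) - 1 / \<epsilon> * (tv_norm (F t) - signed_integral (F t) f) \<le>
        signed_integral (F t) (h 1) - signed_integral (F t) (h (- 1))"
      unfolding signed_integral_diff_bcontfun[OF signed] .
    moreover have "1 - \<epsilon> / 6 \<le> tv_norm (F t) - 1 / \<epsilon> * (tv_norm (F t) - signed_integral (F t) f)"
    proof -
      \<comment> \<open>The norm of \<open>F t\<close> may be below 1. After multiplication by
        \<epsilon> it enters the bound with coefficient \<open>-(1 - \<epsilon>)\<close>, so its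
        upper bound 1 is the worst case.\<close>
      have "(1 - \<epsilon>) * tv_norm (F t) \<le> 1 - \<epsilon>"
        using \<epsilon> measure_ball_tv_norm[OF ball] by (simp add: mult_left_le)
      then have "\<epsilon> * (1 - \<epsilon> / 6) \<le> \<epsilon> * tv_norm (F t) - (tv_norm (F t) - signed_integral (F t) f)"
        using ge by (simp add: algebra_simps power2_eq_square)
      then show ?thesis using \<epsilon> by (simp add: field_simps)
    qed
    ultimately show "1 - \<epsilon> / 6 \<le> signed_integral (F t) (h 1) - signed_integral (F t) (h (- 1))" by linarith
  qed (use h_bounds h_support \<epsilon> in auto)
  moreover have "2 * (\<epsilon> / 6) \<le> \<epsilon>" using \<epsilon> by simp
  ultimately show ?thesis
    using norm_f\<^sub>0 pi2_sub norm_diff by (meson order_trans)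
qed

end
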